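(* Assume $\square_{\aleph_\omega}$. There exist a reduced abelian group $G$ of cardinality $\aleph_{\omega+1}$ and a subgroup $K$ of $G$ of cardinality $\aleph_\omega$ such that $G/K$ is divisible but, for each countable subgroup $C$ of $G$, the divisible part of $G/C$ is countable.
   Context: The background theory is ZFC. The divisible part of an abelian group is its largest divisible subgroup; a group is reduced if its divisible part is zero. For an uncountable cardinal $\kappa$, $\square_\kappa$ denotes the following assertion: there exists a sequence of sets $(C_\xi)$ indexed by the limit ordinals $\xi<\kappa^+$ such that for each such $\xi$: (1) $C_\xi$ is a closed, cofinal subset of $\xi$; (2) if $\mathrm{cf}(\xi)<\kappa$ then $|C_\xi|<\kappa$; (3) if $\eta$ is a limit point of $C_\xi$, then $C_\eta=\eta\cap C_\xi$. *)

theory Defs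
  imports "HOL-Algebra.Generated_Groups" "HOL-Library.Countable_Set"
begin

unbundle cardinal_syntax

section \<open>Alephs\<close>

text \<open>
  Cardinals are rendered as cardinal orders (\<^const>\<open>Card_order\<close>) on subsets of a fixed but
  arbitrary type, and are only relevant up to \<^const>\<open>ordIso\<close>. A type need not be large enough to
  carry a given aleph, so the alephs are predicates rather than functions: the predicate is
  unsatisfiable on a type that is too small. On a type that carries a cardinal, every smaller
  cardinal is carried as well, so restricting the quantifiers below to one type loses nothing.
\<close>

primrec is_aleph :: "nat \<Rightarrow> 'a rel \<Rightarrow> bool" where
  "is_aleph 0 k \<longleftrightarrow> Card_order k \<and> k =o natLeq"
| "is_aleph (Suc n) k \<longleftrightarrow> Card_order k \<and> (\<exists>l :: 'a rel. is_aleph n l \<and> k =o cardSuc l)"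

definition bounds_alephs :: "'a rel \<Rightarrow> bool" where
  "bounds_alephs k \<longleftrightarrow> Card_order k \<and> (\<forall>n. \<exists>l :: 'a rel. is_aleph n l \<and> l \<le>o k)"

definition is_aleph_omega :: "'a rel \<Rightarrow> bool" where
  "is_aleph_omega k \<longleftrightarrow> bounds_alephs k \<and> (\<forall>k' :: 'a rel. bounds_alephs k' \<longrightarrow> k \<le>o k')"

section \<open>The square principle\<close>

text \<open>
  In a well-order \<open>r\<close>, an element \<open>\<xi>\<close> of the field stands for the ordinal that is the order type
  of its set of strict predecessors \<open>underS r \<xi>\<close>. If \<open>r\<close> is a cardinal order, the elements of its
  field thus represent exactly the ordinals below that cardinal.
\<close>

definition limit_ord :: "'a rel \<Rightarrow> 'a \<Rightarrow> bool" where
  "limit_ord r \<xi> \<longleftrightarrow> \<xi> \<in> Field r \<and> underS r \<xi> \<noteq> {} \<and>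
     (\<forall>\<eta>\<in>underS r \<xi>. \<exists>\<zeta>\<in>underS r \<xi>. \<eta> \<in> underS r \<zeta>)"

definition cofinal_in :: "'a rel \<Rightarrow> 'a \<Rightarrow> 'a set \<Rightarrow> bool" where
  "cofinal_in r \<xi> A \<longleftrightarrow> A \<subseteq> underS r \<xi> \<and> (\<forall>\<eta>\<in>underS r \<xi>. \<exists>\<zeta>\<in>A. (\<eta>, \<zeta>) \<in> r)"

definition cofinality :: "'a rel \<Rightarrow> 'a \<Rightarrow> 'a rel" where
  "cofinality r \<xi> = |SOME A. cofinal_in r \<xi> A \<and> (\<forall>B. cofinal_in r \<xi> B \<longrightarrow> |A| \<le>o |B| )|"

text \<open>The strict inequality on both sides makes every limit point a limit ordinal.\<close>

definition limit_point :: "'a rel \<Rightarrow> 'a set \<Rightarrow> 'a \<Rightarrow> bool" where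
  "limit_point r A \<eta> \<longleftrightarrow> \<eta> \<in> Field r \<and> underS r \<eta> \<noteq> {} \<and>
     (\<forall>\<beta>\<in>underS r \<eta>. \<exists>\<zeta>\<in>A. \<beta> \<in> underS r \<zeta> \<and> \<zeta> \<in> underS r \<eta>)"

definition closed_in_ord :: "'a rel \<Rightarrow> 'a \<Rightarrow> 'a set \<Rightarrow> bool" where
  "closed_in_ord r \<xi> A \<longleftrightarrow> A \<subseteq> underS r \<xi> \<and> (\<forall>\<eta>\<in>underS r \<xi>. limit_point r A \<eta> \<longrightarrow> \<eta> \<in> A)"

text \<open>Intended for uncountable cardinal orders \<open>k\<close>; the ordinals range over \<open>cardSuc k\<close>.\<close>

definition square :: "'a rel \<Rightarrow> bool" where
  "square k \<longleftrightarrow>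
     (let r = cardSuc k in
      \<exists>C :: 'a set \<Rightarrow> 'a set set. \<forall>\<xi>. limit_ord r \<xi> \<longrightarrow>
        closed_in_ord r \<xi> (C \<xi>) \<and> cofinal_in r \<xi> (C \<xi>) \<and>
        (cofinality r \<xi> <o k \<longrightarrow> |C \<xi>| <o k) \<and>
        (\<forall>\<eta>. limit_point r (C \<xi>) \<eta> \<longrightarrow> C \<eta> = underS r \<eta> \<inter> C \<xi>))"

lemma cofinality_is_least:
  assumes "cofinal_in r \<xi> B"
  shows "\<exists>A. cofinal_in r \<xi> A \<and> cofinality r \<xi> = |A|" and "cofinality r \<xi> \<le>o |B|"
proof -
  let ?P = "\<lambda>A. cofinal_in r \<xi> A \<and> (\<forall>B. cofinal_in r \<xi> B \<longrightarrow> |A| \<le>o |B| )"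
  have "\<exists>A. ?P A"
    using exists_minim_Card_order[of "card_of ` {A. cofinal_in r \<xi> A}"] assms
    by (auto simp: card_of_Card_order)
  then have "?P (SOME A. ?P A)"
    by (rule someI_ex)
  then show "\<exists>A. cofinal_in r \<xi> A \<and> cofinality r \<xi> = |A|" "cofinality r \<xi> \<le>o |B|"
    using assms unfolding cofinality_def by blast+
qed

section \<open>Divisible groups\<close>

text \<open>Abelian groups are the multiplicatively written groups of \<^locale>\<open>comm_group\<close>.\<close>

definition divisible :: "('a, 'b) monoid_scheme \<Rightarrow> bool" where
  "divisible G \<longleftrightarrow>
     (\<forall>n::nat. n > 0 \<longrightarrow> (\<forall>x\<in>carrier G. \<exists>y\<in>carrier G. y [^]\<^bsub>G\<^esub> n = x))"

definition divisible_subgroup :: "'a set \<Rightarrow> ('a, 'b) monoid_scheme \<Rightarrow> bool" where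
  "divisible_subgroup D G \<longleftrightarrow> subgroup D G \<and> divisible (G\<lparr>carrier := D\<rparr>)"

definition divisible_part :: "('a, 'b) monoid_scheme \<Rightarrow> 'a set" where
  "divisible_part G = (GREATEST D. divisible_subgroup D G)"

definition reduced :: "('a, 'b) monoid_scheme \<Rightarrow> bool" where
  "reduced G \<longleftrightarrow> divisible_part G = {\<one>\<^bsub>G\<^esub>}"

lemma divisible_subgroup_iff:
  "divisible_subgroup D G \<longleftrightarrow>
     subgroup D G \<and> (\<forall>n::nat. n > 0 \<longrightarrow> (\<forall>x\<in>D. \<exists>y\<in>D. y [^]\<^bsub>G\<^esub> n = x))"
  by (simp add: divisible_subgroup_def divisible_def nat_pow_def)

lemma divisible_part_is_largest:
  fixes G (structure)
  assumes "comm_group G"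
  shows "divisible_subgroup (divisible_part G) G"
    and "\<And>D. divisible_subgroup D G \<Longrightarrow> D \<subseteq> divisible_part G"
proof -
  interpret comm_group G by fact
  define U where "U = \<Union>{D. divisible_subgroup D G}"
  have U: "U \<subseteq> carrier G"
    unfolding U_def divisible_subgroup_def by (auto dest: subgroup.subset)
  have D: "\<exists>y\<in>generate G U. y [^] n = x" if "x \<in> generate G U" "n > 0" for x and n :: nat
    using that(1)
  proof (induction rule: generate.induct)
    case one
    then show ?case by (auto intro!: bexI[of _ \<one>] generate.one)
  next
    case (incl h)
    then obtain D where "divisible_subgroup D G" "h \<in> D" by (auto simp: U_def)
    then show ?case
      using that(2) unfolding divisible_subgroup_iff U_def by (blast intro: generate.incl)
  next
    case (inv h)
    then obtain D where D: "divisible_subgroup D G" "h \<in> D" by (auto simp: U_def)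
    then have "inv h \<in> D"
      unfolding divisible_subgroup_def by (auto dest: subgroup.m_inv_closed)
    with D show ?case
      using that(2) unfolding divisible_subgroup_iff U_def by (blast intro: generate.incl)
  next
    case (eng h1 h2)
    then obtain y1 y2 where y: "y1 \<in> generate G U" "y2 \<in> generate G U" "y1 [^] n = h1" "y2 [^] n = h2"
      by blast
    then have "(y1 \<otimes> y2) [^] n = h1 \<otimes> h2"
      using generate_in_carrier[OF U] by (simp add: nat_pow_distrib)
    with y show ?case by (blast intro: generate.eng)
  qed
  have gen: "divisible_subgroup (generate G U) G"
    unfolding divisible_subgroup_iff using D generate_is_subgroup[OF U] by blast
  have max: "D \<subseteq> generate G U" if "divisible_subgroup D G" for D
    using that by (auto simp: U_def intro: generate.incl)
  have "divisible_part G = generate G U"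
    unfolding divisible_part_def by (rule Greatest_equality) (use gen max in auto)
  with gen max show "divisible_subgroup (divisible_part G) G"
    and "\<And>D. divisible_subgroup D G \<Longrightarrow> D \<subseteq> divisible_part G" by simp_all
qed

end

theory Submission
  imports Defs "HOL-Library.Countable_Set_Type" "HOL-Library.Function_Algebras" "HOL.Modules"
begin

text \<open>
  Write \<open>r = \<kappa>\<^sup>+\<close> for \<open>\<kappa> = \<aleph>\<^sub>\<omega>\<close>. The group lives inside the integer-valued functions on
  \<open>I = \<nat> \<times> \<kappa>\<close>. Given functions \<open>f\<^sub>\<alpha> : \<nat> \<rightarrow> \<kappa>\<close> for \<open>\<alpha> < r\<close>, let \<open>y\<^sub>\<alpha>\<close> be the function with value
  \<open>n!\<close> at each point \<open>(n, f\<^sub>\<alpha> n)\<close> of the graph of \<open>f\<^sub>\<alpha>\<close> and \<open>0\<close> elsewhere. Let \<open>K\<close> be the free group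
  of finitely supported functions, and let \<open>M\<close> consist of all functions that have a nonzero integer
  multiple in the subgroup generated by \<open>K\<close> and the \<open>y\<^sub>\<alpha>\<close>. Every \<open>g \<in> M\<close> is divisible by any given
  \<open>N > 0\<close> at all but finitely many points, because \<open>N\<close> divides \<open>n!\<close> for large \<open>n\<close>; dividing \<open>g\<close> by
  \<open>N\<close> at those points shows that \<open>M / K\<close> is divisible. A function that is divisible by every \<open>N\<close>
  vanishes, so \<open>M\<close> is reduced.

  Let \<open>C \<le> M\<close> be countable, and let \<open>X\<close> be the union of the supports of its elements, which is
  countable. If \<open>g\<close> represents an element of the divisible part of \<open>M / C\<close>, then outside \<open>X\<close> the values
  of \<open>g\<close> are divisible by every \<open>N\<close>, so \<open>g\<close> is supported in \<open>X\<close>. If distinct \<open>f\<^sub>\<alpha>\<close> agree at only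
  finitely many arguments, a generator \<open>y\<^sub>\<alpha>\<close> that occurs in \<open>g\<close> cannot be cancelled by the others
  far out, and so \<open>(n, f\<^sub>\<alpha> n) \<in> X\<close> for almost all \<open>n\<close>. Everything therefore comes down to a
  combinatorial property (\<open>square_sparse_family\<close>): for every countable \<open>X\<close> the set \<open>S\<close> of all \<open>\<alpha>\<close> whose
  graph meets \<open>X\<close> infinitely often is countable.

  The square sequence \<open>C\<^sub>\<xi>\<close> gives such \<open>f\<^sub>\<alpha>\<close>. By recursion on \<open>\<delta>\<close> choose \<open>f\<^sub>\<delta> n < \<aleph>\<^sub>n\<^sub>+\<^sub>1\<close> above
  \<open>f\<^sub>\<gamma> n\<close> for at most \<open>\<aleph>\<^sub>n\<close> many \<open>\<gamma> < \<delta>\<close>, where every \<open>\<gamma> < \<delta>\<close> is taken into account for almost all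
  \<open>n\<close>, and moreover all \<open>\<gamma> \<in> C\<^sub>\<delta>\<close> are taken into account as soon as \<open>|C\<^sub>\<delta>| \<le> \<aleph>\<^sub>n\<close>
  (\<open>dominating_functions\<close>). If \<open>S\<close> were uncountable, there would be a least \<open>\<xi>\<close> with uncountably many
  elements of \<open>S\<close> below it. It has cofinality \<open>\<omega>\<^sub>1\<close>, so \<open>|C\<^sub>\<xi>| \<le> \<aleph>\<^sub>N\<close> for some \<open>N\<close> and the limit
  points of \<open>C\<^sub>\<xi>\<close> are cofinal in \<open>\<xi>\<close>. By coherence, \<open>f\<^sub>\<gamma> n < f\<^sub>\<delta> n\<close> for all \<open>n \<ge> N\<close> and all limit points
  \<open>\<gamma> < \<delta>\<close> of \<open>C\<^sub>\<xi>\<close>: the exceptional set does not depend on \<open>\<gamma>\<close> and \<open>\<delta>\<close>. Comparing each \<open>s \<in> S\<close> below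
  \<open>\<xi>\<close> with the limit points around it, a pigeonhole argument on the countable set \<open>X\<close> gives a
  contradiction (\<open>countable_trace_below\<close>).
\<close>

section \<open>Well-orders and regular cardinals\<close>

lemma underS_order:
  assumes "Well_order r"
  shows "a \<in> underS r b \<Longrightarrow> b \<in> underS r c \<Longrightarrow> a \<in> underS r c"
    and "a \<in> Field r \<Longrightarrow> b \<in> Field r \<Longrightarrow> a = b \<or> a \<in> underS r b \<or> b \<in> underS r a"
    and "a \<in> underS r b \<Longrightarrow> a \<in> Field r \<and> b \<in> Field r"
    and "a \<in> underS r b \<Longrightarrow> b \<notin> underS r a"
    and "(a, b) \<in> r \<longleftrightarrow> a \<in> Field r \<and> a = b \<or> a \<in> underS r b"
    and "a \<in> Field r \<Longrightarrow> b \<in> Field r \<Longrightarrow> a \<notin> underS r b \<Longrightarrow> (b, a) \<in> r"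
    and "(a, b) \<in> r \<Longrightarrow> b \<in> underS r c \<Longrightarrow> a \<in> underS r c"
    and "a \<in> underS r b \<Longrightarrow> (b, c) \<in> r \<Longrightarrow> a \<in> underS r c"
proof -
  interpret W: wo_rel r using assms by (simp add: wo_rel_def)
  show "a \<in> underS r b \<Longrightarrow> b \<in> underS r c \<Longrightarrow> a \<in> underS r c"
    using W.TRANS W.ANTISYM unfolding underS_def trans_def antisym_def by blast
  show "a \<in> Field r \<Longrightarrow> b \<in> Field r \<Longrightarrow> a = b \<or> a \<in> underS r b \<or> b \<in> underS r a"
    using W.TOTALS unfolding underS_def by blast
  show "a \<in> underS r b \<Longrightarrow> a \<in> Field r \<and> b \<in> Field r"
    unfolding underS_def Field_def by blast
  show "a \<in> underS r b \<Longrightarrow> b \<notin> underS r a"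
    using W.ANTISYM unfolding underS_def antisym_def by blast
  show "(a, b) \<in> r \<longleftrightarrow> a \<in> Field r \<and> a = b \<or> a \<in> underS r b"
    using W.REFL unfolding underS_def refl_on_def Field_def by blast
  show "a \<in> Field r \<Longrightarrow> b \<in> Field r \<Longrightarrow> a \<notin> underS r b \<Longrightarrow> (b, a) \<in> r"
    using W.TOTALS unfolding underS_def by blast
  show "(a, b) \<in> r \<Longrightarrow> b \<in> underS r c \<Longrightarrow> a \<in> underS r c"
    using W.TRANS W.ANTISYM unfolding underS_def trans_def antisym_def by blast
  show "a \<in> underS r b \<Longrightarrow> (b, c) \<in> r \<Longrightarrow> a \<in> underS r c"
    using W.TRANS W.ANTISYM unfolding underS_def trans_def antisym_def by blast
qed

lemma underS_nonempty_least:
  assumes "Well_order r" "S \<subseteq> Field r" "S \<noteq> {}"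
  shows "\<exists>a\<in>S. \<forall>b\<in>S. b \<notin> underS r a"
proof -
  have "wf (r - Id)" using assms(1) by (simp add: well_order_on_def)
  then obtain a where "a \<in> S" "\<And>b. (b, a) \<in> r - Id \<Longrightarrow> b \<notin> S"
    using assms(3) by (meson wfE_min')
  then show ?thesis unfolding underS_def by blast
qed

lemma regular_bounded:
  assumes "Card_order r" "infinite (Field r)" "regularCard r"
    and "B \<subseteq> Field r" "|B| <o r"
  shows "\<exists>a\<in>Field r. B \<subseteq> underS r a"
proof -
  have "\<not> cofinal B r"
    using assms not_ordLess_ordIso unfolding regularCard_def by blast
  then obtain a where a: "a \<in> Field r" "\<forall>b\<in>B. a = b \<or> (a, b) \<notin> r"
    unfolding cofinal_def by blast
  obtain a' where a': "a' \<in> Field r" "a \<noteq> a'" "(a, a') \<in> r"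
    using infinite_Card_order_limit[OF assms(1,2) a(1)] by blast
  have W: "Well_order r"
    using assms(1) by (simp add: card_order_on_well_order_on)
  have "B \<subseteq> underS r a'"
    using a a' underS_order[OF W] assms(4) by (metis subsetD subsetI)
  then show ?thesis using a' by blast
qed

section \<open>Initial segments of \<open>\<aleph>\<^sub>\<omega>\<close>\<close>

lemma is_aleph_Card_order: "is_aleph n l \<Longrightarrow> Card_order l"
  by (cases n) auto

lemma is_aleph_unique: fixes l l' :: "'a rel" shows "is_aleph n l \<Longrightarrow> is_aleph n l' \<Longrightarrow> l =o l'"
proof (induction n arbitrary: l l')
  case 0
  then show ?case using ordIso_symmetric ordIso_transitive by (auto; blast)
next
  case (Suc n)
  then obtain m m' :: "'a rel" where m: "is_aleph n m" "is_aleph n m'" "l =o cardSuc m" "l' =o cardSuc m'"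
    by auto
  then have "cardSuc m =o cardSuc m'"
    using Suc.IH cardSuc_invar_ordIso is_aleph_Card_order by blast
  then show ?case
    using ordIso_transitive[OF m(3) ordIso_transitive[OF _ ordIso_symmetric[OF m(4)]]] by blast
qed

lemma aleph_omega_Cinfinite:
  fixes k :: "'a rel"
  assumes "is_aleph_omega k"
  shows "Cinfinite k"
proof -
  obtain l :: "'a rel" where l: "is_aleph 0 l" "l \<le>o k" and k: "Card_order k"
    using assms unfolding is_aleph_omega_def bounds_alephs_def by blast
  then have "natLeq \<le>o k" using ordIso_ordLeq_trans[OF ordIso_symmetric] by auto
  from ordLeq_ordIso_trans[OF this ordIso_symmetric[OF card_of_Field_ordIso[OF k]]]
  show ?thesis using k infinite_iff_natLeq_ordLeq[of "Field k"] by (simp add: cinfinite_def)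
qed

text \<open>
  Minimality of \<open>\<aleph>\<^sub>\<omega>\<close> among the bounds of all \<open>\<aleph>\<^sub>n\<close> means that every smaller cardinal lies below some
  \<open>\<aleph>\<^sub>n\<close>. Taking for \<open>A n\<close> the initial segment of \<open>k\<close> of cardinality \<open>\<aleph>\<^sub>n\<close>, this also makes the \<open>A n\<close>
  exhaust \<open>k\<close>.
\<close>

lemma aleph_omega_tower:
  fixes k :: "'a rel"
  assumes "is_aleph_omega k"
  obtains A :: "nat \<Rightarrow> 'a set"
  where "|A 0| =o natLeq" "\<And>n. |A (Suc n)| =o cardSuc |A n|" "mono A" "Field k = (\<Union>n. A n)"
    "\<And>B :: 'a set. |B| <o k \<Longrightarrow> \<exists>n. |B| \<le>o |A n|"
proof -
  have k: "bounds_alephs k" "\<And>k' :: 'a rel. bounds_alephs k' \<Longrightarrow> k \<le>o k'"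
    using assms by (auto simp: is_aleph_omega_def)
  then have Ck: "Card_order k" by (simp add: bounds_alephs_def)
  then have Wk: "Well_order k" by (simp add: card_order_on_well_order_on)
  have "\<exists>l :: 'a rel. is_aleph n l \<and> l \<le>o k" for n
    using k by (simp add: bounds_alephs_def)
  then obtain L :: "nat \<Rightarrow> 'a rel" where L: "\<And>n. is_aleph n (L n)" "\<And>n. L n \<le>o k"
    by metis
  have CL: "Card_order (L n)" for n using L is_aleph_Card_order by blast
  have LS: "L (Suc n) =o cardSuc (L n)" for n
  proof -
    obtain m :: "'a rel" where m: "is_aleph n m" "L (Suc n) =o cardSuc m"
      using L(1)[of "Suc n"] by auto
    then have "cardSuc m =o cardSuc (L n)"
      using L(1) is_aleph_unique cardSuc_invar_ordIso is_aleph_Card_order by blast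
    then show ?thesis using m ordIso_transitive by blast
  qed
  have Lless: "L n <o L (Suc n)" for n
    using cardSuc_greater[OF CL] LS ordIso_symmetric ordLess_ordIso_trans by blast
  have Lk: "L n <o k" for n
    using Lless L(2) ordLess_ordLeq_trans by blast
  have Lmono: "L m \<le>o L n" if "m \<le> n" for m n
    using that
  proof (induction rule: dec_induct)
    case base
    then show ?case using CL by (simp add: card_order_on_well_order_on ordLeq_reflexive)
  next
    case (step n)
    then show ?case using Lless ordLess_imp_ordLeq ordLeq_transitive by blast
  qed
  have exhaust: "\<exists>n. |B| <o L n" if "|B| <o k" for B :: "'a set"
  proof -
    have "\<not> bounds_alephs |B|"
      using that k(2) not_ordLess_ordLeq by blast
    then obtain n where "\<not> L n \<le>o |B|"
      using L(1) unfolding bounds_alephs_def by (auto simp: card_of_Card_order)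
    then show ?thesis
      using CL[of n] not_ordLeq_iff_ordLess[OF card_of_Well_order, of "L n" B] card_order_on_well_order_on
      by blast
  qed
  have "\<exists>a\<in>Field k. L n =o |underS k a|" for n
  proof -
    obtain a where a: "a \<in> Field k" "L n =o Restr k (underS k a)"
      using Lk[of n] ordLess_iff_ordIso_Restr[OF Wk, of "L n"] CL[of n]
      by (auto simp: card_order_on_well_order_on)
    have "Field (Restr k (underS k a)) = underS k a"
      using Wk by (simp add: Field_Restr_ofilter wo_rel.underS_ofilter wo_rel_def)
    then have "|Field (L n)| =o |underS k a|"
      using card_of_cong[OF a(2)] by simp
    then show ?thesis
      using a(1) ordIso_transitive[OF ordIso_symmetric[OF card_of_Field_ordIso[OF CL]]] by blast
  qed
  then obtain a where a: "\<And>n. a n \<in> Field k" "\<And>n. L n =o |underS k (a n)|" by metis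
  have *: "underS k b \<subseteq> underS k c \<or> underS k c \<subseteq> underS k b" "b \<in> underS k c \<or> underS k c \<subseteq> underS k b"
    if "b \<in> Field k" "c \<in> Field k" for b c
    using underS_order(1,3)[OF Wk] underS_order(2)[OF Wk that] by blast+
  show ?thesis
  proof
    show "|underS k (a 0)| =o natLeq"
      using L(1)[of 0] ordIso_transitive[OF ordIso_symmetric[OF a(2)[of 0]], of natLeq] by simp
    show "|underS k (a (Suc n))| =o cardSuc |underS k (a n)|" for n
    proof -
      have "cardSuc (L n) =o cardSuc |underS k (a n)|"
        using a(2)[of n] cardSuc_invar_ordIso[OF CL card_of_Card_order] by blast
      then show ?thesis
        using ordIso_transitive[OF ordIso_symmetric[OF a(2)]] ordIso_transitive[OF LS] by blast
    qed
    show "mono (\<lambda>n. underS k (a n))"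
    proof (rule monoI)
      fix m n :: nat assume "m \<le> n"
      show "underS k (a m) \<subseteq> underS k (a n)"
      proof (cases "m = n")
        case False
        then have "L m <o L n"
          using \<open>m \<le> n\<close> Lless Lmono[of "Suc m" n] ordLess_ordLeq_trans by (metis Suc_leI le_neq_implies_less)
        then have "|underS k (a m)| <o |underS k (a n)|"
          using a(2) ordIso_symmetric ordIso_ordLess_trans ordLess_ordIso_trans by blast
        then have "\<not> underS k (a n) \<subseteq> underS k (a m)"
          using card_of_mono1 not_ordLess_ordLeq by blast
        then show ?thesis using *(1) a(1) by blast
      qed simp
    qed
    show "Field k = (\<Union>n. underS k (a n))"
    proof (intro equalityI subsetI)
      fix b assume b: "b \<in> Field k"
      have "|underS k b| <o k"
        using card_of_underS[OF Ck b] .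
      then obtain n where "|underS k b| <o |underS k (a n)|"
        using exhaust a(2) ordLess_ordIso_trans by blast
      then have "\<not> underS k (a n) \<subseteq> underS k b"
        using card_of_mono1 not_ordLess_ordLeq by blast
      then show "b \<in> (\<Union>n. underS k (a n))" using *(2) a(1) b by blast
    qed (use underS_order(3)[OF Wk] in auto)
    show "\<exists>n. |B| \<le>o |underS k (a n)|" if "|B| <o k" for B :: "'a set"
      using exhaust[OF that] a(2) ordLess_imp_ordLeq ordLeq_ordIso_trans by blast
  qed
qed

section \<open>Functions that increase along a square sequence\<close>

text \<open>
  Recursion along \<open>r\<close>: at stage \<open>\<delta>\<close> the fewer than \<open>|R|\<close> earlier values that matter are bounded
  because \<open>R\<close> is regular.
\<close>

lemma increasing_along:
  fixes r :: "'a rel" and R :: "'b rel" and B :: "'a \<Rightarrow> 'a set"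
  assumes "Well_order r" and R: "Card_order R" "infinite (Field R)" "regularCard R"
    and B: "\<And>\<delta>. B \<delta> \<subseteq> underS r \<delta>" "\<And>\<delta>. |B \<delta>| <o R"
  obtains f where "\<And>\<delta>. f \<delta> \<in> Field R" "\<And>\<gamma> \<delta>. \<gamma> \<in> B \<delta> \<Longrightarrow> f \<gamma> \<in> underS R (f \<delta>)"
proof -
  \<comment> \<open>The guard \<open>f \<gamma> \<in> Field R\<close> makes a value exist for every \<open>f\<close>; it holds for the function obtained.\<close>
  let ?P = "\<lambda>f \<delta> x. x \<in> Field R \<and> (\<forall>\<gamma>\<in>B \<delta>. f \<gamma> \<in> Field R \<longrightarrow> f \<gamma> \<in> underS R x)"
  have "\<exists>f :: 'a \<Rightarrow> 'b. \<forall>\<delta>. ?P f \<delta> (f \<delta>)"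
  proof (rule dependent_wf_choice)
    show "wf (r - Id)" using assms(1) by (simp add: well_order_on_def)
  next
    fix f g :: "'a \<Rightarrow> 'b" and \<delta> x
    assume "\<And>z. (z, \<delta>) \<in> r - Id \<Longrightarrow> f z = g z"
    then show "?P f \<delta> x = ?P g \<delta> x" using B(1) unfolding underS_def by fastforce
  next
    fix \<delta> and f :: "'a \<Rightarrow> 'b"
    have "|f ` B \<delta> \<inter> Field R| <o R"
      using B(2) card_of_image card_of_mono1[of "f ` B \<delta> \<inter> Field R"] ordLeq_ordLess_trans
      by (metis inf_le1 ordLeq_transitive)
    then show "\<exists>x. ?P f \<delta> x"
      using regular_bounded[OF R, of "f ` B \<delta> \<inter> Field R"] by auto
  qed
  then show ?thesis using that by blast
qed

text \<open>
  At coordinate \<open>n\<close> there is room above any \<open>\<aleph>\<^sub>n\<close> earlier values. The predecessors of \<open>\<delta>\<close> inject into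
  \<open>k\<close> and are therefore a union of sets of size \<open>\<aleph>\<^sub>n\<close>, increasing with \<open>n\<close>; taking the \<open>n\<close>-th one into
  account at coordinate \<open>n\<close> makes \<open>f \<delta>\<close> eventually exceed every earlier \<open>f \<gamma>\<close>. Adding \<open>C \<delta>\<close>
  whenever it has at most \<open>\<aleph>\<^sub>n\<close> elements gives domination along \<open>C \<delta>\<close> from a coordinate on that depends
  only on \<open>|C \<delta>|\<close>.
\<close>

lemma dominating_functions:
  fixes k :: "'a rel" and A :: "nat \<Rightarrow> 'a set" and C :: "'a set \<Rightarrow> 'a set set"
  assumes k: "Card_order k" and A: "infinite (A 0)" "\<And>n. |A (Suc n)| =o cardSuc |A n|"
    "mono A" "Field k = (\<Union>n. A n)"
  defines "r \<equiv> cardSuc k"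
  obtains f :: "'a set \<Rightarrow> nat \<Rightarrow> 'a" where "\<And>\<delta> n. f \<delta> n \<in> A (Suc n)"
    "\<And>\<gamma> \<delta>. \<gamma> \<in> underS r \<delta> \<Longrightarrow> \<exists>m. \<forall>n\<ge>m. f \<gamma> n \<in> underS |A (Suc n)| (f \<delta> n)"
    "\<And>\<gamma> \<delta> n. |C \<delta>| \<le>o |A n| \<Longrightarrow> \<gamma> \<in> C \<delta> \<Longrightarrow> \<gamma> \<in> underS r \<delta> \<Longrightarrow>
      f \<gamma> n \<in> underS |A (Suc n)| (f \<delta> n)"
proof -
  have r: "Card_order r" "Well_order r"
    using k by (simp_all add: r_def cardSuc_Card_order cardSuc_Well_order)
  have infA: "infinite (A n)" for n
    using A(1) monoD[OF A(3), of 0 n] finite_subset by auto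
  have "\<exists>j. inj_on j (underS r \<delta>) \<and> j ` underS r \<delta> \<subseteq> Field k" for \<delta>
  proof -
    have "|underS r \<delta>| \<le>o |Field k|"
    proof (cases "\<delta> \<in> Field r")
      case True
      then have "|underS r \<delta>| <o cardSuc k"
        using card_of_underS[OF r(1)] by (simp add: r_def)
      then have "|underS r \<delta>| \<le>o k"
        using cardSuc_ordLess_ordLeq[OF k card_of_Card_order] cardSuc_ordLeq_ordLess[OF k card_of_Card_order] by blast
      then show ?thesis
        using ordLeq_ordIso_trans ordIso_symmetric[OF card_of_Field_ordIso[OF k]] by blast
    next
      case False
      then have "underS r \<delta> = {}" using underS_order(3)[OF r(2)] by blast
      then show ?thesis by (simp add: card_of_empty)
    qed
    then show ?thesis by (simp add: card_of_ordLeq)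
  qed
  then obtain j where j: "\<And>\<delta>. inj_on (j \<delta>) (underS r \<delta>)" "\<And>\<delta>. j \<delta> ` underS r \<delta> \<subseteq> Field k"
    by metis
  \<comment> \<open>The indices below \<open>\<delta>\<close> that \<open>f \<delta> n\<close> has to dominate.\<close>
  define B where "B n \<delta> = {\<gamma> \<in> underS r \<delta>. j \<delta> \<gamma> \<in> A n} \<union>
      (if |C \<delta>| \<le>o |A n| then C \<delta> \<inter> underS r \<delta> else {})" for n \<delta>
  have B: "|B n \<delta>| <o |A (Suc n)|" for n \<delta>
  proof -
    have "|{\<gamma> \<in> underS r \<delta>. j \<delta> \<gamma> \<in> A n}| \<le>o |A n|"
      using j(1)[of \<delta>] unfolding card_of_ordLeq[symmetric]
      by (intro exI[of _ "j \<delta>"]) (auto simp: inj_on_def)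
    moreover have "|if |C \<delta>| \<le>o |A n| then C \<delta> \<inter> underS r \<delta> else {}| \<le>o |A n|"
      using ordLeq_transitive[OF card_of_mono1[of "C \<delta> \<inter> underS r \<delta>" "C \<delta>"], of "|A n|"]
      by (auto simp: card_of_empty)
    ultimately have "|B n \<delta>| \<le>o |A n|"
      unfolding B_def
      by (intro card_of_Un_ordLeq_infinite_Field) (use infA card_of_Card_order in \<open>auto simp: Field_card_of\<close>)
    moreover have "|A n| <o |A (Suc n)|"
      using cardSuc_greater[OF card_of_Card_order] A(2) ordIso_symmetric ordLess_ordIso_trans by blast
    ultimately show ?thesis by (rule ordLeq_ordLess_trans)
  qed
  have reg: "regularCard |A (Suc n)|" for n
  proof -
    have "Cinfinite |A n|"
      using infA[of n] card_of_Card_order by (auto simp: cinfinite_def Field_card_of)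
    then show ?thesis
      using regularCard_ordIso[OF ordIso_symmetric[OF A(2)]] Cinfinite_cardSuc regularCard_cardSuc
      by blast
  qed
  have "\<exists>f. (\<forall>\<delta>. f \<delta> \<in> A (Suc n)) \<and> (\<forall>\<gamma> \<delta>. \<gamma> \<in> B n \<delta> \<longrightarrow> f \<gamma> \<in> underS |A (Suc n)| (f \<delta>))" for n
  proof -
    have "B n \<delta> \<subseteq> underS r \<delta>" for \<delta> by (auto simp: B_def)
    then obtain f where "\<And>\<delta>. f \<delta> \<in> Field |A (Suc n)|"
      "\<And>\<gamma> \<delta>. \<gamma> \<in> B n \<delta> \<Longrightarrow> f \<gamma> \<in> underS |A (Suc n)| (f \<delta>)"
      using increasing_along[OF r(2) card_of_Card_order _ reg, of n "B n"] B infA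
      by (auto simp: Field_card_of)
    then show ?thesis by (intro exI[of _ f]) (simp add: Field_card_of)
  qed
  then obtain f where f: "\<And>n \<delta>. f n \<delta> \<in> A (Suc n)"
    "\<And>n \<gamma> \<delta>. \<gamma> \<in> B n \<delta> \<Longrightarrow> f n \<gamma> \<in> underS |A (Suc n)| (f n \<delta>)"
    by metis
  show ?thesis
  proof (rule that[of "\<lambda>\<delta> n. f n \<delta>"])
    fix \<gamma> \<delta> assume \<gamma>: "\<gamma> \<in> underS r \<delta>"
    then obtain m where "j \<delta> \<gamma> \<in> A m" using j(2)[of \<delta>] A(4) by blast
    then have "\<gamma> \<in> B n \<delta>" if "n \<ge> m" for n
      using \<gamma> monoD[OF A(3) that] by (auto simp: B_def)
    then show "\<exists>m. \<forall>n\<ge>m. f n \<gamma> \<in> underS |A (Suc n)| (f n \<delta>)" using f(2) by blast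
  qed (use f in \<open>auto simp: B_def\<close>)
qed

section \<open>Limit points of closed cofinal sets\<close>

text \<open>
  Climb from \<open>\<gamma>\<close> through an \<open>\<omega>\<close>-sequence of elements of \<open>C\<close>; its supremum stays below \<open>\<xi>\<close> because
  no countable set is cofinal in \<open>\<xi>\<close>.
\<close>

lemma limit_points_unbounded:
  assumes W: "Well_order r" and C: "cofinal_in r \<xi> C"
    and bounded: "\<And>B. countable B \<Longrightarrow> B \<subseteq> underS r \<xi> \<Longrightarrow> \<exists>\<zeta>\<in>underS r \<xi>. B \<subseteq> underS r \<zeta>"
    and \<gamma>: "\<gamma> \<in> underS r \<xi>"
  shows "\<exists>\<eta>\<in>underS r \<xi>. \<gamma> \<in> underS r \<eta> \<and> limit_point r C \<eta>"
proof -
  note lin = underS_order[OF W]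
  have C_sub: "C \<subseteq> underS r \<xi>" using C by (simp add: cofinal_in_def)
  have "\<exists>\<zeta>\<in>C. \<beta> \<in> underS r \<zeta>" if \<beta>: "\<beta> \<in> underS r \<xi>" for \<beta>
  proof -
    obtain \<zeta> where "\<zeta> \<in> underS r \<xi>" "\<beta> \<in> underS r \<zeta>"
      using bounded[OF countable_insert[OF countable_empty, of \<beta>]] \<beta> by auto
    moreover from this obtain c where "c \<in> C" "(\<zeta>, c) \<in> r"
      using C unfolding cofinal_in_def by blast
    ultimately show ?thesis using lin(8)[of \<beta> \<zeta>] by blast
  qed
  then obtain h where h: "\<And>\<beta>. \<beta> \<in> underS r \<xi> \<Longrightarrow> h \<beta> \<in> C \<and> \<beta> \<in> underS r (h \<beta>)"
    by metis
  define g where "g n = (h ^^ n) (h \<gamma>)" for n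
  have g_C: "g n \<in> C" for n
    by (induction n) (use h \<gamma> C_sub in \<open>auto simp: g_def\<close>)
  have g_Suc: "g n \<in> underS r (g (Suc n))" for n
    using h[of "g n"] g_C[of n] C_sub by (auto simp: g_def)
  define U where "U = {\<zeta>. range g \<subseteq> underS r \<zeta>}"
  obtain \<zeta> where \<zeta>: "\<zeta> \<in> underS r \<xi>" "range g \<subseteq> underS r \<zeta>"
    using bounded[of "range g"] g_C C_sub by (auto simp: image_subset_iff)
  have "U \<subseteq> Field r"
  proof
    fix \<zeta> assume "\<zeta> \<in> U"
    then have "g 0 \<in> underS r \<zeta>" by (auto simp: U_def)
    then show "\<zeta> \<in> Field r" using lin(3) by blast
  qed
  then obtain \<eta> where \<eta>: "\<eta> \<in> U" "\<And>\<beta>. \<beta> \<in> U \<Longrightarrow> \<beta> \<notin> underS r \<eta>"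
    using underS_nonempty_least[OF W, of U] \<zeta>(2) by (auto simp: U_def)
  have "\<zeta> \<in> U" using \<zeta>(2) by (simp add: U_def)
  then have "(\<eta>, \<zeta>) \<in> r"
    using \<eta> \<open>U \<subseteq> Field r\<close> by (intro lin(6)) blast+
  then have "\<eta> \<in> underS r \<xi>"
    using \<zeta>(1) by (rule lin(7))
  moreover have "\<gamma> \<in> underS r \<eta>"
  proof (rule lin(1))
    show "\<gamma> \<in> underS r (h \<gamma>)" using h[OF \<gamma>] by simp
    show "h \<gamma> \<in> underS r \<eta>"
      using \<eta>(1) rangeI[of g 0] unfolding U_def g_def by auto
  qed
  moreover have "\<exists>\<zeta>\<in>C. \<beta> \<in> underS r \<zeta> \<and> \<zeta> \<in> underS r \<eta>" if \<beta>: "\<beta> \<in> underS r \<eta>" for \<beta>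
  proof -
    have "\<beta> \<notin> U" using \<eta>(2) \<beta> by blast
    then obtain n where "g n \<notin> underS r \<beta>" by (auto simp: U_def)
    then have "(\<beta>, g n) \<in> r"
      using lin(3)[OF \<beta>] lin(3)[OF g_Suc] by (intro lin(6)) blast+
    then have "\<beta> \<in> underS r (g (Suc n))"
      using g_Suc[of n] by (rule lin(7))
    then show ?thesis using g_C[of "Suc n"] \<eta>(1) by (auto simp: U_def)
  qed
  ultimately show ?thesis using lin(3)[of \<gamma> \<eta>] by (auto simp: limit_point_def)
qed

text \<open>
  The limit points of \<open>C\<close> below \<open>\<xi>\<close> belong to \<open>C\<close>, so a supremum of such points that is not attained
  is again a limit point of \<open>C\<close>.
\<close>

lemma last_limit_point_below:
  assumes W: "Well_order r" and C: "closed_in_ord r \<xi> C"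
    and e: "limit_point r C e" "(e, s) \<in> r" and s: "s \<in> underS r \<xi>"
  shows "\<exists>d. limit_point r C d \<and> (d, s) \<in> r \<and> (\<forall>e. limit_point r C e \<and> (e, s) \<in> r \<longrightarrow> (e, d) \<in> r)"
proof -
  note lin = underS_order[OF W]
  define E where "E = {e. limit_point r C e \<and> (e, s) \<in> r}"
  have E_sub: "E \<subseteq> C" "E \<subseteq> Field r"
    using C lin(7)[OF _ s] unfolding E_def closed_in_ord_def by (auto simp: limit_point_def)
  \<comment> \<open>The least element of \<open>U\<close> is the supremum of \<open>E\<close>.\<close>
  define U where "U = {d. \<forall>e\<in>E. (e, d) \<in> r}"
  have "s \<in> U" by (simp add: U_def E_def)
  have "U \<subseteq> Field r"
  proof
    fix d assume "d \<in> U"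
    then have "(e, d) \<in> r" using e by (simp add: U_def E_def)
    then show "d \<in> Field r" by (auto simp: Field_def)
  qed
  then obtain d where d: "d \<in> U" "\<And>b. b \<in> U \<Longrightarrow> b \<notin> underS r d"
    using underS_nonempty_least[OF W, of U] \<open>s \<in> U\<close> by auto
  have ds: "(d, s) \<in> r"
    using d \<open>s \<in> U\<close> \<open>U \<subseteq> Field r\<close> lin(6)[of s d] by blast
  have "d \<in> E"
  proof (rule ccontr)
    assume "d \<notin> E"
    have "\<exists>\<zeta>\<in>C. \<beta> \<in> underS r \<zeta> \<and> \<zeta> \<in> underS r d" if \<beta>: "\<beta> \<in> underS r d" for \<beta>
    proof -
      have "\<beta> \<notin> U" using d(2) \<beta> by blast
      then obtain e where "e \<in> E" "(e, \<beta>) \<notin> r" by (auto simp: U_def)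
      then have "e \<in> C" "e \<in> Field r" "(e, d) \<in> r" "e \<noteq> d"
        using d(1) E_sub \<open>d \<notin> E\<close> unfolding U_def by auto
      moreover from this have "\<beta> \<in> underS r e"
        using lin(2)[of \<beta> e] lin(3)[OF \<beta>] lin(5)[of e \<beta>] \<open>(e, \<beta>) \<notin> r\<close> by metis
      ultimately show ?thesis unfolding underS_def by blast
    qed
    moreover have "e \<in> underS r d"
      using d(1) e \<open>d \<notin> E\<close> unfolding U_def E_def underS_def by auto
    ultimately have "limit_point r C d"
      using lin(3)[of e d] by (auto simp: limit_point_def)
    then show False using ds \<open>d \<notin> E\<close> by (simp add: E_def)
  qed
  then have "limit_point r C d" by (simp add: E_def)
  moreover have "\<forall>e. limit_point r C e \<and> (e, s) \<in> r \<longrightarrow> (e, d) \<in> r"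
    using d(1) by (simp add: E_def U_def)
  ultimately show ?thesis using ds by blast
qed

section \<open>Countable traces\<close>

lemma uncountable_fibre:
  assumes "uncountable S" "countable X" "\<And>s. s \<in> S \<Longrightarrow> h s \<in> X"
  shows "\<exists>x\<in>X. uncountable {s \<in> S. h s = x}"
proof (rule ccontr)
  assume *: "\<not> (\<exists>x\<in>X. uncountable {s \<in> S. h s = x})"
  have "countable (\<Union>x\<in>X. {s \<in> S. h s = x})"
    by (rule countable_UN[OF assms(2)]) (use * in blast)
  moreover have "S \<subseteq> (\<Union>x\<in>X. {s \<in> S. h s = x})"
    using assms(3) by (intro subsetI) simp
  ultimately show False using assms(1) countable_subset by metis
qed

lemma uncountable_obtain_aleph1:
  assumes "uncountable S"
  obtains T where "T \<subseteq> S" "uncountable T" "|T| \<le>o cardSuc natLeq"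
proof -
  let ?F = "Field (cardSuc natLeq)"
  have F: "|?F| =o cardSuc natLeq"
    by (rule card_of_Field_ordIso[OF cardSuc_Card_order[OF natLeq_Card_order]])
  have nF: "natLeq <o |?F|"
    by (rule ordLess_ordIso_trans[OF cardSuc_greater[OF natLeq_Card_order] ordIso_symmetric[OF F]])
  have "natLeq <o |S|"
    using assms not_ordLeq_iff_ordLess[OF natLeq_Well_order card_of_Well_order, of S]
    by (simp add: countable_card_le_natLeq)
  then have "cardSuc natLeq \<le>o |S|"
    by (intro cardSuc_least natLeq_Card_order card_of_Card_order)
  from ordIso_ordLeq_trans[OF F this] have "|?F| \<le>o |S|" .
  then obtain g where g: "inj_on g ?F" "g ` ?F \<subseteq> S" by (auto simp flip: card_of_ordLeq)
  have gF: "|g ` ?F| =o |?F|"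
    using ordIso_symmetric[OF card_of_ordIsoI[OF inj_on_imp_bij_betw[OF g(1)]]] .
  show ?thesis
  proof
    show "g ` ?F \<subseteq> S" by fact
    show "uncountable (g ` ?F)"
      using not_ordLess_ordLeq[OF nF] ordIso_ordLeq_trans[OF ordIso_symmetric[OF gF], of natLeq]
      unfolding countable_card_le_natLeq by blast
    show "|g ` ?F| \<le>o cardSuc natLeq"
      using ordIso_imp_ordLeq[OF ordIso_transitive[OF gF F]] .
  qed
qed

text \<open>
  The assumption \<open>good\<close> provides, at points of cofinality at most \<open>\<omega>\<^sub>1\<close>, a set \<open>C\<close> along whose limit
  points \<open>f\<close> increases at all coordinates from a fixed \<open>N\<close> on. Let \<open>\<xi>\<close> be least with uncountable
  trace. No countable set is cofinal in \<open>\<xi>\<close>, whereas any \<open>\<omega>\<^sub>1\<close> elements of the trace are.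
  From the first limit point on, each \<open>s \<in> S\<close> below \<open>\<xi>\<close> lies between limit points \<open>d' \<le> s < d\<close> of \<open>C\<close>, where \<open>d'\<close> is the last one not
  above \<open>s\<close>, and there is \<open>n \<ge> N\<close> such that \<open>(n, f s n) \<in> X\<close> and \<open>f d' n \<le> f s n < f d n\<close>.
  As \<open>X\<close> is countable, uncountably many \<open>s\<close> share the same pair \<open>(n, f s n)\<close>. Among these choose
  \<open>s\<close> and \<open>t\<close> such that \<open>t\<close> is not below the limit point \<open>d\<close> chosen for \<open>s\<close>. Then \<open>d\<close> is at most the
  point \<open>d'\<close> chosen for \<open>t\<close>, and \<open>f s n < f d n \<le> f d' n \<le> f t n = f s n\<close> is absurd.
\<close>

lemma countable_trace_below:
  fixes r :: "'b rel" and R :: "nat \<Rightarrow> 'a rel" and f :: "'b \<Rightarrow> nat \<Rightarrow> 'a"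
  assumes W: "Well_order r" and WR: "\<And>n. Well_order (R n)"
    and X: "countable X" and trace: "\<And>s m. s \<in> S \<Longrightarrow> \<exists>n\<ge>m. (n, f s n) \<in> X"
    and incr: "\<And>\<gamma> \<delta>. \<gamma> \<in> underS r \<delta> \<Longrightarrow> \<exists>m. \<forall>n\<ge>m. f \<gamma> n \<in> underS (R n) (f \<delta> n)"
    and good: "\<And>\<xi>. limit_ord r \<xi> \<Longrightarrow> cofinality r \<xi> \<le>o cardSuc natLeq \<Longrightarrow>
      \<exists>C N. cofinal_in r \<xi> C \<and> closed_in_ord r \<xi> C \<and>
        (\<forall>\<gamma> \<delta>. limit_point r C \<gamma> \<and> limit_point r C \<delta> \<and> \<gamma> \<in> underS r \<delta> \<and> \<delta> \<in> underS r \<xi> \<longrightarrow>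
          (\<forall>n\<ge>N. f \<gamma> n \<in> underS (R n) (f \<delta> n)))"
  shows "countable (S \<inter> underS r \<xi>)"
proof -
  note lin = underS_order[OF W]
  have "wf (r - Id)" using W by (simp add: well_order_on_def)
  then show ?thesis
  proof (induction \<xi> rule: wf_induct_rule)
    case (less \<xi>)
    have below: "countable (S \<inter> underS r \<beta>)" "countable {s \<in> S. (s, \<beta>) \<in> r}"
      if "\<beta> \<in> underS r \<xi>" for \<beta>
    proof -
      show *: "countable (S \<inter> underS r \<beta>)"
        using less that by (auto simp: underS_def)
      have "{s \<in> S. (s, \<beta>) \<in> r} \<subseteq> insert \<beta> (S \<inter> underS r \<beta>)"
        by (auto simp: underS_def)
      then show "countable {s \<in> S. (s, \<beta>) \<in> r}"
        by (rule countable_subset) (use * in simp)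
    qed
    show ?case
    proof (rule ccontr)
      assume unc: "uncountable (S \<inter> underS r \<xi>)"
      have bounded: "\<exists>\<zeta>\<in>underS r \<xi>. B \<subseteq> underS r \<zeta>"
        if B: "countable B" "B \<subseteq> underS r \<xi>" for B
      proof (rule ccontr)
        assume *: "\<not> ?thesis"
        have sub: "S \<inter> underS r \<xi> \<subseteq> (\<Union>b\<in>B. {s \<in> S. (s, b) \<in> r})"
        proof
          fix s assume s: "s \<in> S \<inter> underS r \<xi>"
          then obtain b where "b \<in> B" "b \<notin> underS r s" using * by blast
          moreover from this have "(s, b) \<in> r"
            using s B(2) lin(3)[of b \<xi>] lin(3)[of s \<xi>] by (intro lin(6)) auto
          ultimately show "s \<in> (\<Union>b\<in>B. {s \<in> S. (s, b) \<in> r})" using s by blast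
        qed
        have "countable (\<Union>b\<in>B. {s \<in> S. (s, b) \<in> r})"
          using B below(2) by blast
        with countable_subset[OF sub] unc show False by simp
      qed
      have "S \<inter> underS r \<xi> \<noteq> {}" using unc by force
      then have lim: "limit_ord r \<xi>"
        unfolding limit_ord_def
      proof (intro conjI ballI)
        show "\<exists>\<zeta>\<in>underS r \<xi>. \<eta> \<in> underS r \<zeta>" if "\<eta> \<in> underS r \<xi>" for \<eta>
          using bounded[of "{\<eta>}"] that by simp
      qed (use lin(3)[of _ \<xi>] in auto)
      obtain T where T: "T \<subseteq> S \<inter> underS r \<xi>" "uncountable T" "|T| \<le>o cardSuc natLeq"
        using uncountable_obtain_aleph1[OF unc] by blast
      have "cofinal_in r \<xi> T"
        unfolding cofinal_in_def
      proof (intro conjI ballI)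
        fix \<eta> assume \<eta>: "\<eta> \<in> underS r \<xi>"
        then have "\<not> T \<subseteq> S \<inter> underS r \<eta>"
          using T(2) countable_subset[OF _ below(1)[OF \<eta>], of T] by auto
        then obtain t where "t \<in> T" "t \<notin> underS r \<eta>" using T(1) by blast
        moreover from this have "(\<eta>, t) \<in> r"
          using T(1) lin(3)[OF \<eta>] lin(3)[of t \<xi>] by (intro lin(6)) auto
        ultimately show "\<exists>\<zeta>\<in>T. (\<eta>, \<zeta>) \<in> r" by blast
      qed (use T in auto)
      then have "cofinality r \<xi> \<le>o cardSuc natLeq"
        using ordLeq_transitive[OF cofinality_is_least(2) T(3)] by simp
      then obtain C N where C: "cofinal_in r \<xi> C" "closed_in_ord r \<xi> C"
        and inc_C: "\<And>\<gamma> \<delta> n. limit_point r C \<gamma> \<Longrightarrow> limit_point r C \<delta> \<Longrightarrow> \<gamma> \<in> underS r \<delta> \<Longrightarrow>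
          \<delta> \<in> underS r \<xi> \<Longrightarrow> n \<ge> N \<Longrightarrow> f \<gamma> n \<in> underS (R n) (f \<delta> n)"
        using good[OF lim] by blast
      note limit_above = limit_points_unbounded[OF W C(1) bounded]
      obtain e where e: "limit_point r C e" "e \<in> underS r \<xi>"
        using limit_above lim unfolding limit_ord_def by auto
      \<comment> \<open>A point that is not below the limit point \<open>e\<close> has a last limit point at or below it.\<close>
      define S' where "S' = {s \<in> S \<inter> underS r \<xi>. (e, s) \<in> r}"
      have "S \<inter> underS r \<xi> \<subseteq> S' \<union> (S \<inter> underS r e)"
        using lin(3)[OF e(2)] lin(6)[of _ e] lin(3)[of _ \<xi>] unfolding S'_def by auto
      then have "uncountable S'"
        using unc countable_subset[of "S \<inter> underS r \<xi>" "S' \<union> (S \<inter> underS r e)"] below(1)[OF e(2)] by auto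
      define P where "P s d d' n \<longleftrightarrow> limit_point r C d \<and> d \<in> underS r \<xi> \<and>
          limit_point r C d' \<and> (d', s) \<in> r \<and>
          (\<forall>e. limit_point r C e \<and> (e, s) \<in> r \<longrightarrow> (e, d') \<in> r) \<and>
          n \<ge> N \<and> (n, f s n) \<in> X \<and> f s n \<in> underS (R n) (f d n) \<and>
          (d' = s \<or> f d' n \<in> underS (R n) (f s n))" for s d d' n
      have "\<exists>d d' n. P s d d' n" if s: "s \<in> S'" for s
      proof -
        obtain d where d: "limit_point r C d" "d \<in> underS r \<xi>" "s \<in> underS r d"
          using limit_above[of s] s by (auto simp: S'_def)
        obtain d' where d': "limit_point r C d'" "(d', s) \<in> r"
          "\<forall>e. limit_point r C e \<and> (e, s) \<in> r \<longrightarrow> (e, d') \<in> r"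
          using last_limit_point_below[OF W C(2) e(1)] s by (auto simp: S'_def)
        obtain m where m: "\<And>n. n \<ge> m \<Longrightarrow> f s n \<in> underS (R n) (f d n)"
          using incr[OF d(3)] by blast
        obtain m' where m': "\<And>n. n \<ge> m' \<Longrightarrow> d' = s \<or> f d' n \<in> underS (R n) (f s n)"
          using incr[of d' s] d'(2) lin(5)[of d' s] by auto
        obtain n where "n \<ge> max N (max m m')" "(n, f s n) \<in> X"
          using trace[of s "max N (max m m')"] s by (auto simp: S'_def)
        then show ?thesis using d d' m[of n] m'[of n] by (auto simp: P_def)
      qed
      then have "\<forall>s\<in>S'. \<exists>d d' n. P s d d' n" ..
      then obtain d d' n where all: "\<forall>s\<in>S'. P s (d s) (d' s) (n s)"
        unfolding bchoice_iff by blast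
      have d: "limit_point r C (d s)" "d s \<in> underS r \<xi>" if "s \<in> S'" for s
        using all that unfolding P_def by blast+
      have d': "limit_point r C (d' s)" "(d' s, s) \<in> r"
          "\<And>e. limit_point r C e \<Longrightarrow> (e, s) \<in> r \<Longrightarrow> (e, d' s) \<in> r" if "s \<in> S'" for s
        using all that unfolding P_def by blast+
      have n: "n s \<ge> N" "(n s, f s (n s)) \<in> X" "f s (n s) \<in> underS (R (n s)) (f (d s) (n s))"
          "d' s = s \<or> f (d' s) (n s) \<in> underS (R (n s)) (f s (n s))" if "s \<in> S'" for s
        using all that unfolding P_def by blast+
      obtain x where x: "uncountable {s \<in> S'. (n s, f s (n s)) = x}" (is "uncountable ?U")
        using uncountable_fibre[OF \<open>uncountable S'\<close> X, of "\<lambda>s. (n s, f s (n s))"] n(2) by blast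
      have "?U \<noteq> {}" using x by (rule contrapos_nn) (simp only: countable_empty)
      then obtain s where s: "s \<in> ?U" by blast
      have "\<not> ?U \<subseteq> S \<inter> underS r (d s)"
        using x countable_subset[OF _ below(1)[OF d(2), of s], of ?U] s by auto
      then obtain t where t: "t \<in> ?U" "t \<notin> underS r (d s)"
        using S'_def by auto
      have S': "s \<in> S'" "t \<in> S'" and same: "n s = n t" "f s (n t) = f t (n t)"
        using s t by auto
      have "(d s, t) \<in> r"
        using S'(2) t(2) lin(3)[OF d(2)[OF S'(1)]] lin(3)[of t \<xi>]
        unfolding S'_def by (intro lin(6)) auto
      then have "(d s, d' t) \<in> r" using d' d S' by blast
      moreover have "d' t \<in> underS r \<xi>"
        using lin(7)[OF d'(2)[OF S'(2)]] S'(2) unfolding S'_def by auto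
      ultimately have "d' t = d s \<or> f (d s) (n t) \<in> underS (R (n t)) (f (d' t) (n t))"
        using inc_C[of "d s" "d' t" "n t"] d(1) d'(1) S' n(1) lin(5)[of "d s" "d' t"] by metis
      moreover have "f t (n t) \<in> underS (R (n t)) (f (d s) (n t))"
        using n(3)[OF S'(1)] same by simp
      ultimately have "f t (n t) \<in> underS (R (n t)) (f t (n t))"
        using n(4)[OF S'(2)] underS_order(1)[OF WR[of "n t"]] by metis
      then show False using underS_order(4)[OF WR] by blast
    qed
  qed
qed

text \<open>
  At a point \<open>\<xi>\<close> of cofinality at most \<open>\<omega>\<^sub>1\<close> the set \<open>C \<xi>\<close> has size at most some \<open>\<aleph>\<^sub>N\<close>, and by coherence
  so has \<open>C \<delta> = C \<xi> \<inter> \<delta>\<close> for every limit point \<open>\<delta>\<close> of \<open>C \<xi>\<close>; hence \<open>f \<delta>\<close> dominates \<open>f \<gamma>\<close>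
  from \<open>N\<close> on for all limit points \<open>\<gamma> < \<delta>\<close> of \<open>C \<xi>\<close>. Uncountability of a trace is already seen below
  some point, because \<open>\<omega>\<^sub>1\<close> elements are bounded in the regular cardinal \<open>r\<close>.
\<close>

lemma square_sparse_family:
  fixes k :: "'a rel"
  assumes k: "is_aleph_omega k" and sq: "square k"
  defines "r \<equiv> cardSuc k"
  obtains f :: "'a set \<Rightarrow> nat \<Rightarrow> 'a" where "\<And>\<delta> n. f \<delta> n \<in> Field k"
    "\<And>\<gamma> \<delta>. \<gamma> \<in> Field r \<Longrightarrow> \<delta> \<in> Field r \<Longrightarrow> \<gamma> \<noteq> \<delta> \<Longrightarrow> \<exists>m. \<forall>n\<ge>m. f \<gamma> n \<noteq> f \<delta> n"
    "\<And>X. countable X \<Longrightarrow> countable {\<delta> \<in> Field r. \<forall>m. \<exists>n\<ge>m. (n, f \<delta> n) \<in> X}"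
proof -
  obtain A :: "nat \<Rightarrow> 'a set" where A: "|A 0| =o natLeq" "\<And>n. |A (Suc n)| =o cardSuc |A n|"
    "mono A" "Field k = (\<Union>n. A n)" and A_cof: "\<And>B :: 'a set. |B| <o k \<Longrightarrow> \<exists>n. |B| \<le>o |A n|"
    using aleph_omega_tower[OF k] by metis
  have Cinf: "Cinfinite k" by (rule aleph_omega_Cinfinite[OF k])
  then have Ck: "Card_order k" by simp
  have r: "Card_order r" "Well_order r"
    using Ck by (simp_all add: r_def cardSuc_Card_order cardSuc_Well_order)
  have infA: "infinite (A 0)"
    using ordIso_imp_ordLeq[OF ordIso_symmetric[OF A(1)]] infinite_iff_natLeq_ordLeq[of "A 0"]
    by blast
  have A_sub: "A n \<subseteq> Field k" for n unfolding A(4) by blast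
  have "regularCard r" "infinite (Field r)"
    unfolding r_def using regularCard_cardSuc[OF Cinf] Cinfinite_cardSuc[OF Cinf]
    by (simp_all add: cinfinite_def)
  have aleph1: "cardSuc natLeq <o k"
  proof -
    have "cardSuc |A 0| =o cardSuc natLeq"
      using A(1) cardSuc_invar_ordIso[OF card_of_Card_order natLeq_Card_order] by blast
    then have 1: "cardSuc natLeq =o |A (Suc 0)|"
      using ordIso_symmetric[OF ordIso_transitive[OF A(2)]] by blast
    have 2: "|A (Suc 0)| <o |A (Suc (Suc 0))|"
      by (rule ordLess_ordIso_trans[OF cardSuc_greater[OF card_of_Card_order] ordIso_symmetric[OF A(2)]])
    have 3: "|A (Suc (Suc 0))| \<le>o k"
      by (rule ordLeq_ordIso_trans[OF card_of_mono1[OF A_sub] card_of_Field_ordIso[OF Ck]])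
    show ?thesis
      using ordIso_ordLess_trans[OF 1 ordLess_ordLeq_trans[OF 2 3]] .
  qed
  obtain C :: "'a set \<Rightarrow> 'a set set" where C: "\<And>\<xi>. limit_ord r \<xi> \<Longrightarrow>
        closed_in_ord r \<xi> (C \<xi>) \<and> cofinal_in r \<xi> (C \<xi>) \<and>
        (cofinality r \<xi> <o k \<longrightarrow> |C \<xi>| <o k) \<and>
        (\<forall>\<eta>. limit_point r (C \<xi>) \<eta> \<longrightarrow> C \<eta> = underS r \<eta> \<inter> C \<xi>)"
    using sq unfolding square_def r_def Let_def by blast
  obtain f :: "'a set \<Rightarrow> nat \<Rightarrow> 'a" where f: "\<And>\<delta> n. f \<delta> n \<in> A (Suc n)"
    "\<And>\<gamma> \<delta>. \<gamma> \<in> underS r \<delta> \<Longrightarrow> \<exists>m. \<forall>n\<ge>m. f \<gamma> n \<in> underS |A (Suc n)| (f \<delta> n)"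
    "\<And>\<gamma> \<delta> n. |C \<delta>| \<le>o |A n| \<Longrightarrow> \<gamma> \<in> C \<delta> \<Longrightarrow> \<gamma> \<in> underS r \<delta> \<Longrightarrow>
      f \<gamma> n \<in> underS |A (Suc n)| (f \<delta> n)"
    using dominating_functions[OF Ck infA A(2-4), of C] unfolding r_def by blast
  show ?thesis
  proof
    show "f \<delta> n \<in> Field k" for \<delta> n using f(1) A_sub by blast
    show "\<exists>m. \<forall>n\<ge>m. f \<gamma> n \<noteq> f \<delta> n" if "\<gamma> \<in> Field r" "\<delta> \<in> Field r" "\<gamma> \<noteq> \<delta>" for \<gamma> \<delta>
    proof -
      have "\<gamma> \<in> underS r \<delta> \<or> \<delta> \<in> underS r \<gamma>"
        using underS_order(2)[OF r(2)] that by blast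
      then obtain m where "\<forall>n\<ge>m. f \<gamma> n \<in> underS |A (Suc n)| (f \<delta> n) \<or> f \<delta> n \<in> underS |A (Suc n)| (f \<gamma> n)"
        using f(2)[of \<gamma> \<delta>] f(2)[of \<delta> \<gamma>] by blast
      then show ?thesis by (intro exI[of _ m]) (auto simp: underS_def)
    qed
    fix X :: "(nat \<times> 'a) set" assume X: "countable X"
    define S where "S = {\<delta> \<in> Field r. \<forall>m. \<exists>n\<ge>m. (n, f \<delta> n) \<in> X}"
    have trace: "\<exists>n\<ge>m. (n, f s n) \<in> X" if "s \<in> S" for s m
      using that by (simp add: S_def)
    have good: "\<exists>C N. cofinal_in r \<xi> C \<and> closed_in_ord r \<xi> C \<and>
        (\<forall>\<gamma> \<delta>. limit_point r C \<gamma> \<and> limit_point r C \<delta> \<and> \<gamma> \<in> underS r \<delta> \<and> \<delta> \<in> underS r \<xi> \<longrightarrow>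
          (\<forall>n\<ge>N. f \<gamma> n \<in> underS |A (Suc n)| (f \<delta> n)))"
      if \<xi>: "limit_ord r \<xi>" "cofinality r \<xi> \<le>o cardSuc natLeq" for \<xi>
    proof -
      have "|C \<xi>| <o k"
        using C[OF \<xi>(1)] ordLeq_ordLess_trans[OF \<xi>(2) aleph1] by simp
      have "\<exists>N. |C \<xi>| \<le>o |A N|"
      proof -
        obtain B :: "'a set" where B: "|C \<xi>| =o |B|"
          using internalize_card_of_ordLeq[of "C \<xi>" k] ordLess_imp_ordLeq[OF \<open>|C \<xi>| <o k\<close>] by blast
        then have "|B| <o k"
          using ordIso_ordLess_trans[OF ordIso_symmetric[OF B] \<open>|C \<xi>| <o k\<close>] by simp
        then obtain n where "|B| \<le>o |A n|" using A_cof by blast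
        from ordIso_ordLeq_trans[OF B this] show ?thesis by blast
      qed
      then obtain N where N: "|C \<xi>| \<le>o |A N|" by blast
      have "f \<gamma> n \<in> underS |A (Suc n)| (f \<delta> n)"
        if "limit_point r (C \<xi>) \<gamma>" "limit_point r (C \<xi>) \<delta>" "\<gamma> \<in> underS r \<delta>" "\<delta> \<in> underS r \<xi>" "n \<ge> N"
        for \<gamma> \<delta> n
      proof (rule f(3))
        have "\<gamma> \<in> underS r \<xi>" using underS_order(1)[OF r(2)] that(3,4) by blast
        then have "\<gamma> \<in> C \<xi>" using C[OF \<xi>(1)] that(1) by (simp add: closed_in_ord_def)
        moreover have C\<delta>: "C \<delta> = underS r \<delta> \<inter> C \<xi>" using C[OF \<xi>(1)] that(2) by blast
        ultimately show "\<gamma> \<in> C \<delta>" using that(3) by blast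
        have "|C \<delta>| \<le>o |C \<xi>|" by (rule card_of_mono1) (simp add: C\<delta>)
        moreover have "|A N| \<le>o |A n|" by (rule card_of_mono1) (rule monoD[OF A(3) that(5)])
        ultimately show "|C \<delta>| \<le>o |A n|" 
          using ordLeq_transitive[OF ordLeq_transitive[OF _ N]] by blast
      qed fact
      then show ?thesis using C[OF \<xi>(1)] by (intro exI[of _ "C \<xi>"] exI[of _ N]) blast
    qed
    have below: "countable (S \<inter> underS r \<xi>)" for \<xi>
      by (rule countable_trace_below[OF r(2) card_of_Well_order X trace f(2) good])
    have "countable S"
    proof (rule ccontr)
      assume "uncountable S"
      then obtain T where T: "T \<subseteq> S" "uncountable T" "|T| \<le>o cardSuc natLeq"
        by (rule uncountable_obtain_aleph1)
      have "k <o r" unfolding r_def by (rule cardSuc_greater[OF Ck])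
      then have "|T| <o r"
        by (rule ordLeq_ordLess_trans[OF T(3) ordLess_transitive[OF aleph1]])
      moreover have "T \<subseteq> Field r" using T(1) by (auto simp: S_def)
      ultimately obtain a where "T \<subseteq> underS r a"
        using regular_bounded[OF r(1) \<open>infinite (Field r)\<close> \<open>regularCard r\<close>] by blast
      then show False using T(1,2) countable_subset[OF _ below[of a], of T] by simp
    qed
    then show "countable {\<delta> \<in> Field r. \<forall>m. \<exists>n\<ge>m. (n, f \<delta> n) \<in> X}"
      by (simp only: S_def)
  qed
qed

section \<open>Pure hulls in groups of integer-valued functions\<close>

definition scale :: "int \<Rightarrow> ('i \<Rightarrow> int) \<Rightarrow> 'i \<Rightarrow> int" where
  "scale c g = (\<lambda>i. c * g i)"

interpretation fun_int: module scale
  by unfold_locales (auto simp: scale_def fun_eq_iff algebra_simps)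

definition support :: "('i \<Rightarrow> int) \<Rightarrow> 'i set" where
  "support g = {i. g i \<noteq> 0}"

text \<open>
  As the ambient group is torsion-free, this is the smallest pure subgroup that contains \<open>U\<close>.
\<close>

definition pure_hull :: "('i \<Rightarrow> int) set \<Rightarrow> ('i \<Rightarrow> int) set" where
  "pure_hull U = {g. \<exists>m. m \<noteq> 0 \<and> scale m g \<in> fun_int.span U}"

lemma span_subset_pure_hull: "fun_int.span U \<subseteq> pure_hull U"
  unfolding pure_hull_def by (auto simp: scale_def intro!: exI[of _ 1])

lemma pure_hull_mono: "U \<subseteq> V \<Longrightarrow> pure_hull U \<subseteq> pure_hull V"
  using fun_int.span_mono unfolding pure_hull_def by blast

lemma pure_hull_unscale:
  assumes "scale m g \<in> pure_hull U" "m \<noteq> 0"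
  shows "g \<in> pure_hull U"
proof -
  obtain l where "l \<noteq> 0" "scale l (scale m g) \<in> fun_int.span U"
    using assms(1) by (auto simp: pure_hull_def)
  moreover have "scale l (scale m g) = scale (l * m) g" by (simp add: scale_def mult.assoc)
  ultimately show ?thesis
    using assms(2) unfolding pure_hull_def by (auto intro!: exI[of _ "l * m"])
qed

lemma subspace_pure_hull: "fun_int.subspace (pure_hull U)"
proof (rule fun_int.subspaceI)
  show "0 \<in> pure_hull U" using span_subset_pure_hull fun_int.span_zero by blast
  fix g assume "g \<in> pure_hull U"
  then obtain m where m: "m \<noteq> 0" "scale m g \<in> fun_int.span U" by (auto simp: pure_hull_def)
  show "scale c g \<in> pure_hull U" for c
    using m fun_int.span_scale[OF m(2), of c] unfolding pure_hull_def
    by (auto intro!: exI[of _ m] simp: scale_def mult.left_commute)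
  fix h assume "h \<in> pure_hull U"
  then obtain l where l: "l \<noteq> 0" "scale l h \<in> fun_int.span U" by (auto simp: pure_hull_def)
  have "scale (m * l) (g + h) = scale l (scale m g) + scale m (scale l h)"
    by (auto simp: scale_def algebra_simps fun_eq_iff)
  then have "scale (m * l) (g + h) \<in> fun_int.span U"
    using fun_int.span_add[OF fun_int.span_scale[OF m(2)] fun_int.span_scale[OF l(2)]] by simp
  then show "g + h \<in> pure_hull U"
    using m(1) l(1) unfolding pure_hull_def by (auto intro!: exI[of _ "m * l"])
qed

lemma countable_ordLeq_infinite:
  assumes "countable A" "Card_order r" "infinite (Field r)"
  shows "|A| \<le>o r"
proof -
  have "|A| \<le>o natLeq" using assms(1) by (simp add: countable_card_le_natLeq)
  moreover have "natLeq \<le>o |Field r|" using assms(3) infinite_iff_natLeq_ordLeq[of "Field r"] by blast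
  ultimately show ?thesis
    using ordLeq_ordIso_trans[OF ordLeq_transitive card_of_Field_ordIso[OF assms(2)]] by blast
qed

text \<open>
  The span is exhausted by countably many stages, each stage adding one more multiple of a generator.
  Stated for an upper bound \<open>r\<close> of \<open>|U|\<close>, the lemma covers countable sets as well as large ones.
\<close>

lemma card_of_span:
  fixes U :: "('i \<Rightarrow> int) set"
  assumes r: "Card_order r" "infinite (Field r)" and U: "|U| \<le>o r"
  shows "|fun_int.span U| \<le>o r"
proof -
  define L where "L n = ((\<lambda>L. (\<lambda>((c, u), v). scale c u + v) ` ((UNIV \<times> U) \<times> L)) ^^ n) {0}" for n
  have ctb: "|UNIV :: int set| \<le>o r" "|UNIV :: nat set| \<le>o r" "|{0 :: 'i \<Rightarrow> int}| \<le>o r"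
    using r by (simp_all add: countable_ordLeq_infinite)
  have "|L n| \<le>o r" for n
  proof (induction n)
    case 0
    then show ?case using ctb(3) by (simp add: L_def)
  next
    case (Suc n)
    have "|((UNIV :: int set) \<times> U) \<times> L n| \<le>o r"
      using Suc ctb(1) U r by (intro card_of_Times_ordLeq_infinite_Field) auto
    from ordLeq_transitive[OF card_of_image this] show ?case by (simp add: L_def)
  qed
  then have UN: "|\<Union>n. L n| \<le>o r"
    using r ctb(2) by (intro card_of_UNION_ordLeq_infinite_Field) auto
  have "fun_int.span U \<subseteq> (\<Union>n. L n)"
  proof
    fix x assume "x \<in> fun_int.span U"
    then show "x \<in> (\<Union>n. L n)"
    proof (induction rule: fun_int.span_induct_alt)
      case base
      have "0 \<in> L 0" by (simp add: L_def)
      then show ?case by blast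
    next
      case (step c u v)
      then obtain n where "v \<in> L n" by blast
      then have "(\<lambda>((c, u), v). scale c u + v) ((c, u), v) \<in> L (Suc n)"
        using step unfolding L_def funpow.simps o_def by (intro imageI) simp
      then have "scale c u + v \<in> L (Suc n)" by simp
      then show ?case by blast
    qed
  qed
  from ordLeq_transitive[OF card_of_mono1[OF this] UN] show ?thesis .
qed

lemma inj_scale: "m \<noteq> 0 \<Longrightarrow> inj (scale m)"
  by (auto simp: inj_def scale_def fun_eq_iff)

text \<open>
  An element \<open>g\<close> of the hull is determined by \<open>m\<close> and the multiple \<open>m g\<close> in the span, since
  multiplication by \<open>m \<noteq> 0\<close> is injective.
\<close>

lemma card_of_pure_hull:
  fixes U :: "('i \<Rightarrow> int) set"
  assumes r: "Card_order r" "infinite (Field r)" and U: "|U| \<le>o r"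
  shows "|pure_hull U| \<le>o r"
proof -
  have "|scale m -` fun_int.span U| \<le>o r" if "m \<in> - {0}" for m
  proof -
    have "|scale m -` fun_int.span U| \<le>o |fun_int.span U|"
      using inj_scale[of m] that unfolding card_of_ordLeq[symmetric]
      by (intro exI[of _ "scale m"]) (auto simp: inj_on_def inj_def)
    from ordLeq_transitive[OF this card_of_span[OF r U]] show ?thesis .
  qed
  moreover have "|- {0 :: int}| \<le>o r"
    using r by (simp add: countable_ordLeq_infinite)
  ultimately have "|\<Union>m\<in>-{0}. scale m -` fun_int.span U| \<le>o r"
    using r by (intro card_of_UNION_ordLeq_infinite_Field) auto
  moreover have "pure_hull U = (\<Union>m\<in>-{0}. scale m -` fun_int.span U)"
    by (auto simp: pure_hull_def)
  ultimately show ?thesis by simp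
qed

lemma countable_pure_hull: "countable U \<Longrightarrow> countable (pure_hull U)"
  using card_of_pure_hull[OF natLeq_Card_order, of U] by (simp add: countable_card_le_natLeq Field_natLeq)

definition unit_vec :: "'i \<Rightarrow> 'i \<Rightarrow> int" where
  "unit_vec i = (\<lambda>j. if j = i then 1 else 0)"

lemma sum_fun_apply: "sum F A x = (\<Sum>a\<in>A. F a x)"
  for F :: "'c \<Rightarrow> 'i \<Rightarrow> int"
  by (induction A rule: infinite_finite_induct) auto

lemma finite_support_in_span:
  assumes "finite (support g)" "support g \<subseteq> I"
  shows "g \<in> fun_int.span (unit_vec ` I)"
proof -
  have "g = (\<Sum>i\<in>support g. scale (g i) (unit_vec i))"
  proof
    fix j
    have "(\<Sum>i\<in>support g. scale (g i) (unit_vec i)) j = (\<Sum>i\<in>support g. if j = i then g i else 0)"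
      by (simp add: sum_fun_apply scale_def unit_vec_def if_distrib cong: if_cong)
    also have "\<dots> = g j" using assms(1) by (simp add: support_def)
    finally show "g j = (\<Sum>i\<in>support g. scale (g i) (unit_vec i)) j" by simp
  qed
  also have "\<dots> \<in> fun_int.span (unit_vec ` I)"
    using assms(2) by (intro fun_int.span_sum fun_int.span_scale fun_int.span_base) auto
  finally show ?thesis .
qed

lemma subspace_finite_support:
  "fun_int.subspace {g. finite (support g) \<and> support g \<subseteq> I}"
proof (rule fun_int.subspaceI)
  fix g h :: "'a \<Rightarrow> int"
  assume *: "g \<in> {g. finite (support g) \<and> support g \<subseteq> I}" "h \<in> {g. finite (support g) \<and> support g \<subseteq> I}"
  have "support (g + h) \<subseteq> support g \<union> support h" by (auto simp: support_def)
  then show "g + h \<in> {g. finite (support g) \<and> support g \<subseteq> I}"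
    using * finite_subset[of "support (g + h)" "support g \<union> support h"] by auto
next
  fix c and g :: "'a \<Rightarrow> int"
  assume *: "g \<in> {g. finite (support g) \<and> support g \<subseteq> I}"
  have "support (scale c g) \<subseteq> support g" by (auto simp: support_def scale_def)
  then show "scale c g \<in> {g. finite (support g) \<and> support g \<subseteq> I}"
    using * finite_subset[of "support (scale c g)" "support g"] by auto
qed (auto simp: support_def)

lemma span_unit_vec: "fun_int.span (unit_vec ` I) = {g. finite (support g) \<and> support g \<subseteq> I}"
proof
  have "support (unit_vec i) = {i}" for i :: 'a by (auto simp: support_def unit_vec_def)
  then show "fun_int.span (unit_vec ` I) \<subseteq> {g. finite (support g) \<and> support g \<subseteq> I}"
    by (intro fun_int.span_minimal subspace_finite_support) auto
qed (use finite_support_in_span in auto)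

lemma zero_if_all_dvd:
  fixes x :: int
  assumes "\<And>n :: nat. n > 0 \<Longrightarrow> int n dvd x"
  shows "x = 0"
proof (rule ccontr)
  assume "x \<noteq> 0"
  moreover have "int (nat \<bar>x\<bar> + 1) dvd x" using assms[of "nat \<bar>x\<bar> + 1"] by simp
  ultimately show False using zdvd_imp_le[of "int (nat \<bar>x\<bar> + 1)" "\<bar>x\<bar>"] by simp
qed

section \<open>The group built from a sparse family of functions\<close>

locale sparse_family =
  fixes B :: "'a set" and J :: "'b set" and f :: "'b \<Rightarrow> nat \<Rightarrow> 'a"
  assumes f_in: "\<And>\<alpha> n. f \<alpha> n \<in> B"
    and almost_disjoint:
      "\<And>\<alpha> \<beta>. \<alpha> \<in> J \<Longrightarrow> \<beta> \<in> J \<Longrightarrow> \<alpha> \<noteq> \<beta> \<Longrightarrow> \<forall>\<^sub>F n in sequentially. f \<alpha> n \<noteq> f \<beta> n"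
    and countable_trace: "\<And>X. countable X \<Longrightarrow> countable {\<alpha> \<in> J. \<exists>\<^sub>F n in sequentially. (n, f \<alpha> n) \<in> X}"
begin

text \<open>
  The factorials make almost all values of \<open>ray \<alpha>\<close> divisible by any given integer.
\<close>

definition ray :: "'b \<Rightarrow> nat \<times> 'a \<Rightarrow> int" where
  "ray \<alpha> = (\<lambda>(n, \<xi>). if \<xi> = f \<alpha> n then fact n else 0)"

definition K :: "(nat \<times> 'a \<Rightarrow> int) set" where
  "K = fun_int.span (unit_vec ` (UNIV \<times> B))"

definition M :: "(nat \<times> 'a \<Rightarrow> int) set" where
  "M = pure_hull (unit_vec ` (UNIV \<times> B) \<union> ray ` J)"

lemma K_eq: "K = {g. finite (support g) \<and> support g \<subseteq> UNIV \<times> B}"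
  by (simp add: K_def span_unit_vec)

lemma subspace_M: "fun_int.subspace M"
  by (simp add: M_def subspace_pure_hull)

lemma K_subset_M: "K \<subseteq> M"
  unfolding K_def M_def
  by (rule subset_trans[OF span_subset_pure_hull pure_hull_mono]) simp

text \<open>
  The functions with this property form a pure subgroup, so it is enough to check the generators.
\<close>

lemma M_finite_nondvd:
  assumes "g \<in> M" "N > 0"
  shows "finite {i. \<not> int N dvd g i}"
proof -
  let ?D = "{g :: nat \<times> 'a \<Rightarrow> int. \<forall>N>0. finite {i. \<not> int N dvd g i}}"
  have D: "fun_int.subspace ?D"
  proof (rule fun_int.subspaceI; safe)
    fix g h :: "nat \<times> 'a \<Rightarrow> int" and N :: nat
    assume *: "\<forall>N>0. finite {i. \<not> int N dvd g i}" "\<forall>N>0. finite {i. \<not> int N dvd h i}" "N > 0"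
    have "{i. \<not> int N dvd (g + h) i} \<subseteq> {i. \<not> int N dvd g i} \<union> {i. \<not> int N dvd h i}" by auto
    then show "finite {i. \<not> int N dvd (g + h) i}" 
      by (rule finite_subset) (use * in simp)
  next
    fix g :: "nat \<times> 'a \<Rightarrow> int" and N :: nat and c
    assume *: "\<forall>N>0. finite {i. \<not> int N dvd g i}" "N > 0"
    have "{i. \<not> int N dvd scale c g i} \<subseteq> {i. \<not> int N dvd g i}" by (auto simp: scale_def)
    then show "finite {i. \<not> int N dvd scale c g i}" 
      by (rule finite_subset) (use * in simp)
  qed simp
  have "unit_vec i \<in> ?D" for i :: "nat \<times> 'a"
  proof (safe)
    fix N :: nat assume "N > 0"
    have "{j. \<not> int N dvd unit_vec i j} \<subseteq> {i}" by (auto simp: unit_vec_def)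
    then show "finite {j. \<not> int N dvd unit_vec i j}" by (rule finite_subset) simp
  qed
  moreover have "ray \<alpha> \<in> ?D" for \<alpha>
  proof (safe)
    fix N :: nat assume N: "N > 0"
    have "int N dvd fact n" if "N \<le> n" for n
    proof -
      have "N dvd fact n" using N that by (intro dvd_fact) auto
      then have "int N dvd int (fact n)" by (simp only: of_nat_dvd_iff)
      then show ?thesis by simp
    qed
    then have *: "n < N" if "\<not> int N dvd fact n" for n using that by (meson not_le)
    have "{i. \<not> int N dvd ray \<alpha> i} \<subseteq> (\<lambda>n. (n, f \<alpha> n)) ` {..<N}"
      by (auto simp: ray_def * split: if_splits)
    then show "finite {i. \<not> int N dvd ray \<alpha> i}" by (rule finite_subset) simp
  qed
  ultimately have span: "fun_int.span (unit_vec ` (UNIV \<times> B) \<union> ray ` J) \<subseteq> ?D"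
    by (intro fun_int.span_minimal D) auto
  obtain m where m: "m \<noteq> 0" "scale m g \<in> ?D"
    using assms(1) span unfolding M_def pure_hull_def by blast
  have "int N dvd g i" if "int (nat \<bar>m\<bar> * N) dvd scale m g i" for i
  proof -
    have "int (nat \<bar>m\<bar> * N) = \<bar>m * int N\<bar>" by (simp add: abs_mult)
    then have "m * int N dvd m * g i" using that by (simp add: scale_def)
    then show ?thesis using m(1) by simp
  qed
  then have "{i. \<not> int N dvd g i} \<subseteq> {i. \<not> int (nat \<bar>m\<bar> * N) dvd scale m g i}" by blast
  moreover have "finite {i. \<not> int (nat \<bar>m\<bar> * N) dvd scale m g i}"
  proof -
    have "nat \<bar>m\<bar> * N > 0" using m(1) assms(2) by simp
    then show ?thesis using m(2) by blast
  qed
  ultimately show ?thesis by (rule finite_subset)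
qed

text \<open>
  A nonzero integer fails to be divisible by some \<open>N\<close>, so the support is a countable union of the finite
  sets of \<open>M_finite_nondvd\<close>.
\<close>

lemma M_countable_support: "g \<in> M \<Longrightarrow> countable (support g)"
proof -
  assume g: "g \<in> M"
  have "support g \<subseteq> (\<Union>N\<in>{0<..}. {i. \<not> int N dvd g i})"
  proof
    fix i assume "i \<in> support g"
    then show "i \<in> (\<Union>N\<in>{0<..}. {i. \<not> int N dvd g i})"
      using zero_if_all_dvd[of "g i"] by (auto simp: support_def)
  qed
  moreover have "countable (\<Union>N\<in>{0<..}. {i. \<not> int N dvd g i})"
    using M_finite_nondvd[OF g] countable_finite by (intro countable_UN) auto
  ultimately show ?thesis by (rule countable_subset)
qed

lemma M_support: "g \<in> M \<Longrightarrow> support g \<subseteq> UNIV \<times> B"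
proof -
  assume "g \<in> M"
  then obtain m where m: "m \<noteq> 0" "scale m g \<in> fun_int.span (unit_vec ` (UNIV \<times> B) \<union> ray ` J)"
    by (auto simp: M_def pure_hull_def)
  have "fun_int.subspace {g :: nat \<times> 'a \<Rightarrow> int. support g \<subseteq> UNIV \<times> B}"
  proof (rule fun_int.subspaceI; safe)
    fix g h :: "nat \<times> 'a \<Rightarrow> int" and n x
    assume "support g \<subseteq> UNIV \<times> B" "support h \<subseteq> UNIV \<times> B" "(n, x) \<in> support (g + h)"
    moreover from this have "(n, x) \<in> support g \<union> support h" by (auto simp: support_def)
    ultimately show "x \<in> B" by blast
  qed (auto simp: support_def scale_def)
  then have "fun_int.span (unit_vec ` (UNIV \<times> B) \<union> ray ` J) \<subseteq> {g. support g \<subseteq> UNIV \<times> B}"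
    by (rule fun_int.span_minimal[rotated])
      (use f_in in \<open>auto simp: support_def unit_vec_def ray_def split: if_splits\<close>)
  then have "support (scale m g) \<subseteq> UNIV \<times> B" using m(2) by auto
  moreover have "support (scale m g) = support g" using m(1) by (auto simp: support_def scale_def)
  ultimately show ?thesis by simp
qed

text \<open>
  Divide \<open>g\<close> by \<open>N\<close> wherever this is possible; what is left has finite support. The quotient \<open>h\<close> stays in
  \<open>M\<close> because \<open>M\<close> is pure.
\<close>

lemma M_div_K:
  assumes g: "g \<in> M" and N: "N > 0"
  shows "\<exists>h\<in>M. \<exists>c\<in>K. g = scale (int N) h + c"
proof -
  define h where "h i = (if int N dvd g i then g i div int N else 0)" for i
  define c where "c = g - scale (int N) h"
  have c: "c i = (if int N dvd g i then 0 else g i)" for i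
    by (auto simp: c_def h_def scale_def)
  have "support c \<subseteq> {i. \<not> int N dvd g i}" "support c \<subseteq> support g"
    by (auto simp: support_def c split: if_splits)
  then have "c \<in> K"
    using finite_subset[OF _ M_finite_nondvd[OF g N], of "support c"] M_support[OF g]
    unfolding K_eq by blast
  then have "scale (int N) h \<in> M"
    using fun_int.subspace_diff[OF subspace_M g, of c] K_subset_M by (auto simp: c_def)
  then have "h \<in> M" using N pure_hull_unscale[of "int N" h] unfolding M_def by simp
  moreover have "g = scale (int N) h + c" by (simp add: c_def)
  ultimately show ?thesis using \<open>c \<in> K\<close> by blast
qed

lemma span_ray:
  assumes "y \<in> fun_int.span (ray ` J)"
  obtains A a where "finite A" "A \<subseteq> J" "\<And>\<alpha>. \<alpha> \<in> A \<Longrightarrow> a \<alpha> \<noteq> 0" "y = (\<Sum>\<alpha>\<in>A. scale (a \<alpha>) (ray \<alpha>))"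
proof -
  obtain t c where t: "finite t" "t \<subseteq> ray ` J" "y = (\<Sum>u\<in>t. scale (c u) u)"
    using assms unfolding fun_int.span_explicit by blast
  then obtain A where A: "A \<subseteq> J" "inj_on ray A" "t = ray ` A"
    unfolding subset_image_inj by blast
  have "finite A" using t(1) finite_imageD[OF _ A(2)] A(3) by simp
  have "y = (\<Sum>\<alpha>\<in>A. scale (c (ray \<alpha>)) (ray \<alpha>))"
    using A by (simp add: t(3) sum.reindex)
  also have "\<dots> = (\<Sum>\<alpha>\<in>{\<alpha>\<in>A. c (ray \<alpha>) \<noteq> 0}. scale (c (ray \<alpha>)) (ray \<alpha>))"
    using \<open>finite A\<close> by (intro sum.mono_neutral_right) (auto simp: scale_def fun_eq_iff)
  finally show ?thesis
    using \<open>finite A\<close> A(1) by (intro that[of "{\<alpha>\<in>A. c (ray \<alpha>) \<noteq> 0}" "\<lambda>\<alpha>. c (ray \<alpha>)"]) auto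
qed

text \<open>
  A multiple of \<open>g\<close> is \<open>x + \<Sum> a\<^sub>\<alpha> y\<^sub>\<alpha>\<close> with \<open>x\<close> of finite support and finitely many \<open>a\<^sub>\<alpha> \<noteq> 0\<close>. For large
  \<open>n\<close> its value at \<open>(n, f\<^sub>\<alpha> n)\<close> is \<open>a\<^sub>\<alpha> n! \<noteq> 0\<close> by almost disjointness, so every \<open>\<alpha>\<close> that occurs has
  infinite trace on \<open>X\<close>. Hence \<open>g\<close> lies in the pure hull of countably many generators: the \<open>y\<^sub>\<alpha>\<close> with
  infinite trace, and the unit vectors at points of \<open>X\<close> or on the graphs of these \<open>f\<^sub>\<alpha>\<close>.
\<close>

lemma countable_supported_in_countable:
  assumes X: "countable X"
  shows "countable {g \<in> M. support g \<subseteq> X}"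
proof -
  define S where "S = {\<alpha> \<in> J. \<exists>\<^sub>F n in sequentially. (n, f \<alpha> n) \<in> X}"
  define X' where "X' = X \<union> (\<Union>\<alpha>\<in>S. range (\<lambda>n. (n, f \<alpha> n)))"
  have S: "countable S" unfolding S_def by (rule countable_trace[OF X])
  then have "countable (pure_hull (unit_vec ` X' \<union> ray ` S))"
    using X by (intro countable_pure_hull) (simp add: X'_def)
  moreover have "{g \<in> M. support g \<subseteq> X} \<subseteq> pure_hull (unit_vec ` X' \<union> ray ` S)"
  proof safe
    fix g assume g: "g \<in> M" "support g \<subseteq> X"
    obtain m where m: "m \<noteq> 0" "scale m g \<in> fun_int.span (unit_vec ` (UNIV \<times> B) \<union> ray ` J)"
      using g(1) by (auto simp: M_def pure_hull_def)
    then obtain x y where xy: "x \<in> K" "y \<in> fun_int.span (ray ` J)" "scale m g = x + y"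
      unfolding fun_int.span_Un K_def by blast
    obtain A a where A: "finite A" "A \<subseteq> J" "\<And>\<alpha>. \<alpha> \<in> A \<Longrightarrow> a \<alpha> \<noteq> 0"
      and y: "y = (\<Sum>\<alpha>\<in>A. scale (a \<alpha>) (ray \<alpha>))"
      using span_ray[OF xy(2)] by blast
    have y_apply: "y i = (\<Sum>\<alpha>\<in>A. a \<alpha> * ray \<alpha> i)" for i
      by (simp add: y sum_fun_apply scale_def)
    have "A \<subseteq> S"
    proof
      fix \<alpha> assume \<alpha>: "\<alpha> \<in> A"
      have "\<forall>\<^sub>F n in sequentially. \<forall>\<beta>\<in>A - {\<alpha>}. f \<alpha> n \<noteq> f \<beta> n"
        using A(1,2) \<alpha> by (intro eventually_ball_finite ballI almost_disjoint) auto
      moreover have "\<forall>\<^sub>F n in sequentially. n \<notin> fst ` support x"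
      proof -
        have "finite (fst ` support x)" using xy(1) by (simp add: K_eq)
        then obtain N where "\<forall>n\<in>fst ` support x. n < N" unfolding finite_nat_set_iff_bounded by blast
        then show ?thesis unfolding eventually_sequentially by (intro exI[of _ N]) force
      qed
      ultimately have "\<forall>\<^sub>F n in sequentially. (n, f \<alpha> n) \<in> X"
      proof eventually_elim
        case (elim n)
        have "x (n, f \<alpha> n) = 0" using elim(2) by (force simp: support_def)
        moreover have "y (n, f \<alpha> n) = (\<Sum>\<beta>\<in>{\<alpha>}. a \<beta> * ray \<beta> (n, f \<alpha> n))"
          unfolding y_apply using A(1) \<alpha> elim(1)
          by (intro sum.mono_neutral_right) (auto simp: ray_def)
        ultimately have "scale m g (n, f \<alpha> n) = a \<alpha> * fact n"
          by (simp add: xy(3) ray_def)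
        then have "g (n, f \<alpha> n) \<noteq> 0" using A(3)[OF \<alpha>] by (auto simp: scale_def)
        then show ?case using g(2) by (auto simp: support_def)
      qed
      then have "\<exists>\<^sub>F n in sequentially. (n, f \<alpha> n) \<in> X"
        by (intro eventually_frequently) auto
      then show "\<alpha> \<in> S" using \<alpha> A(2) by (auto simp: S_def)
    qed
    then have "y \<in> fun_int.span (ray ` S)"
      unfolding y by (intro fun_int.span_sum fun_int.span_scale fun_int.span_base) auto
    have "support y \<subseteq> X'"
    proof
      fix i assume "i \<in> support y"
      then obtain \<alpha> where "\<alpha> \<in> A" "ray \<alpha> i \<noteq> 0"
        unfolding support_def y_apply by (auto elim!: sum.not_neutral_contains_not_neutral)
      then show "i \<in> X'" using \<open>A \<subseteq> S\<close> by (force simp: X'_def ray_def split: if_splits prod.splits)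
    qed
    moreover have "support (scale m g) \<subseteq> X'"
      using g(2) by (auto simp: support_def scale_def X'_def)
    ultimately have "support x \<subseteq> X'"
      using xy(3) by (auto simp: support_def fun_eq_iff subset_iff) (metis add.right_neutral)
    then have "x \<in> fun_int.span (unit_vec ` X')"
      using xy(1) by (intro finite_support_in_span) (simp_all add: K_eq)
    then have "scale m g \<in> fun_int.span (unit_vec ` X' \<union> ray ` S)"
      unfolding fun_int.span_Un xy(3) using \<open>y \<in> fun_int.span (ray ` S)\<close> by blast
    then show "g \<in> pure_hull (unit_vec ` X' \<union> ray ` S)"
      using m(1) by (auto simp: pure_hull_def)
  qed
  ultimately show ?thesis by (rule countable_subset[rotated])
qed

text \<open>
  At points where all elements of \<open>C\<close> vanish, the values of \<open>g\<close> are divisible by every \<open>N\<close>, hence zero.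
\<close>

lemma countable_divisible_modulo:
  assumes C: "countable C" "C \<subseteq> M"
  shows "countable {g \<in> M. \<forall>N>0. \<exists>h\<in>M. \<exists>c\<in>C. g = scale (int N) h + c}"
proof -
  have "countable (\<Union>c\<in>C. support c)"
    using C M_countable_support by (intro countable_UN) auto
  then have "countable {g \<in> M. support g \<subseteq> (\<Union>c\<in>C. support c)}"
    by (rule countable_supported_in_countable)
  moreover have "{g \<in> M. \<forall>N>0. \<exists>h\<in>M. \<exists>c\<in>C. g = scale (int N) h + c}
      \<subseteq> {g \<in> M. support g \<subseteq> (\<Union>c\<in>C. support c)}"
  proof safe
    fix g i
    assume *: "\<forall>N>0. \<exists>h\<in>M. \<exists>c\<in>C. g = scale (int N) h + c" and i: "i \<in> support g"
    show "i \<in> (\<Union>c\<in>C. support c)"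
    proof (rule ccontr)
      assume "i \<notin> (\<Union>c\<in>C. support c)"
      then have zero: "c i = 0" if "c \<in> C" for c using that by (auto simp: support_def)
      have "int N dvd g i" if N: "N > 0" for N
      proof -
        obtain h c where "c \<in> C" "g = scale (int N) h + c" using * N by metis
        then have "g i = int N * h i" using zero by (simp add: scale_def)
        then show ?thesis by simp
      qed
      then show False using zero_if_all_dvd[of "g i"] i by (simp add: support_def)
    qed
  qed
  ultimately show ?thesis by (rule countable_subset[rotated])
qed

lemma M_reduced:
  assumes "\<And>N. N > 0 \<Longrightarrow> \<exists>h. g = scale (int N) h"
  shows "g = 0"
proof
  fix i
  have "int N dvd g i" if "N > 0" for N using assms[OF that] by (auto simp: scale_def)
  then show "g i = 0 i" using zero_if_all_dvd[of "g i"] by simp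
qed

lemma inj_on_ray: "inj_on ray J"
proof (rule inj_onI, rule ccontr)
  fix \<alpha> \<beta> assume *: "\<alpha> \<in> J" "\<beta> \<in> J" "ray \<alpha> = ray \<beta>" "\<alpha> \<noteq> \<beta>"
  then obtain n where "f \<alpha> n \<noteq> f \<beta> n"
    using eventually_happens[OF almost_disjoint] by auto
  then show False using fun_cong[OF *(3), of "(n, f \<alpha> n)"] by (simp add: ray_def)
qed

lemma card_of_K:
  assumes "Card_order k" "infinite B" "|B| =o k"
  shows "|K| =o k"
proof -
  have k: "infinite (Field k)"
    using assms(2) card_of_ordIso_finite[OF card_of_cong[OF assms(3)]] by (simp add: Field_card_of)
  have I: "|UNIV \<times> B :: (nat \<times> 'a) set| \<le>o k"
    using assms k countable_ordLeq_infinite[OF _ assms(1) k, of "UNIV :: nat set"]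
    by (intro card_of_Times_ordLeq_infinite_Field) (auto simp: ordIso_imp_ordLeq)
  then have "|unit_vec ` (UNIV \<times> B :: (nat \<times> 'a) set)| \<le>o k"
    by (rule ordLeq_transitive[OF card_of_image])
  then have "|K| \<le>o k" unfolding K_def by (rule card_of_span[OF assms(1) k])
  moreover have "|B| \<le>o |K|"
    unfolding card_of_ordLeq[symmetric]
  proof (intro exI[of _ "\<lambda>b. unit_vec (0, b)"] conjI)
    show "inj_on (\<lambda>b. unit_vec (0 :: nat, b)) B"
      by (auto simp: inj_on_def unit_vec_def fun_eq_iff split: if_splits)
    show "(\<lambda>b. unit_vec (0, b)) ` B \<subseteq> K"
      unfolding K_def using fun_int.span_base by (auto intro!: fun_int.span_base)
  qed
  ultimately show ?thesis
    using ordIso_ordLeq_trans[OF ordIso_symmetric[OF assms(3)]] by (simp add: ordIso_iff_ordLeq)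
qed

lemma card_of_M:
  assumes "Card_order r" "infinite J" "|J| =o r" "|B| \<le>o r"
  shows "|M| =o r"
proof -
  have r: "infinite (Field r)"
    using assms(2) card_of_ordIso_finite[OF card_of_cong[OF assms(3)]] by (simp add: Field_card_of)
  have I: "|UNIV \<times> B :: (nat \<times> 'a) set| \<le>o r"
    using assms r countable_ordLeq_infinite[OF _ assms(1) r, of "UNIV :: nat set"]
    by (intro card_of_Times_ordLeq_infinite_Field) auto
  have "|unit_vec ` (UNIV \<times> B :: (nat \<times> 'a) set)| \<le>o r" "|ray ` J| \<le>o r"
    using ordLeq_transitive[OF card_of_image I]
      ordLeq_transitive[OF card_of_image ordIso_imp_ordLeq[OF assms(3)]] by blast+
  then have "|unit_vec ` (UNIV \<times> B) \<union> ray ` J| \<le>o r"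
    using r assms(1) by (intro card_of_Un_ordLeq_infinite_Field)
  then have "|M| \<le>o r" unfolding M_def by (rule card_of_pure_hull[OF assms(1) r])
  moreover have "|J| \<le>o |M|"
    unfolding card_of_ordLeq[symmetric]
  proof (intro exI[of _ ray] conjI inj_on_ray)
    have "ray ` J \<subseteq> fun_int.span (unit_vec ` (UNIV \<times> B) \<union> ray ` J)"
      by (auto intro: fun_int.span_base)
    then show "ray ` J \<subseteq> M" unfolding M_def using span_subset_pure_hull by blast
  qed
  ultimately show ?thesis
    using ordIso_ordLeq_trans[OF ordIso_symmetric[OF assms(3)]] by (simp add: ordIso_iff_ordLeq)
qed

end

section \<open>Divisible parts in terms of elements\<close>

lemma reduced_if_no_divisible_element:
  assumes "comm_group G"
    and "\<And>x. x \<in> carrier G \<Longrightarrow> (\<And>n::nat. n > 0 \<Longrightarrow> \<exists>y\<in>carrier G. y [^]\<^bsub>G\<^esub> n = x) \<Longrightarrow> x = \<one>\<^bsub>G\<^esub>"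
  shows "reduced G"
proof -
  have D: "subgroup (divisible_part G) G"
    "\<And>n x. n > (0::nat) \<Longrightarrow> x \<in> divisible_part G \<Longrightarrow> \<exists>y\<in>divisible_part G. y [^]\<^bsub>G\<^esub> n = x"
    using divisible_part_is_largest(1)[OF assms(1)] unfolding divisible_subgroup_iff by blast+
  have "x = \<one>\<^bsub>G\<^esub>" if x: "x \<in> divisible_part G" for x
  proof (rule assms(2))
    show "x \<in> carrier G" using subgroup.subset[OF D(1)] x by blast
    show "\<exists>y\<in>carrier G. y [^]\<^bsub>G\<^esub> n = x" if "n > 0" for n :: nat
      using D(2)[OF that x] subgroup.subset[OF D(1)] by blast
  qed
  then show ?thesis using subgroup.one_closed[OF D(1)] unfolding reduced_def by blast
qed

lemma divisible_FactGroup: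
  assumes "comm_group G" "subgroup K G"
    and div: "\<And>n x. n > (0::nat) \<Longrightarrow> x \<in> carrier G \<Longrightarrow>
      \<exists>y\<in>carrier G. \<exists>c\<in>K. x = c \<otimes>\<^bsub>G\<^esub> y [^]\<^bsub>G\<^esub> n"
  shows "divisible (G Mod K)"
  unfolding divisible_def
proof (intro allI impI ballI)
  interpret comm_group G by fact
  interpret K: normal K G using assms(2) by (simp add: subgroup_imp_normal)
  fix n :: nat and X assume n: "n > 0" and "X \<in> carrier (G Mod K)"
  then obtain x where x: "x \<in> carrier G" "X = K #>\<^bsub>G\<^esub> x" by (auto simp: carrier_FactGroup)
  obtain y c where y: "y \<in> carrier G" "c \<in> K" "x = c \<otimes>\<^bsub>G\<^esub> y [^]\<^bsub>G\<^esub> n"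
    using div[OF n x(1)] by blast
  have "x \<in> K #>\<^bsub>G\<^esub> (y [^]\<^bsub>G\<^esub> n)" using y by (auto simp: r_coset_def)
  then have "K #>\<^bsub>G\<^esub> (y [^]\<^bsub>G\<^esub> n) = X"
    using repr_independence[OF _ _ assms(2)] y(1) x(2) by simp
  then show "\<exists>Y\<in>carrier (G Mod K). Y [^]\<^bsub>G Mod K\<^esub> n = X"
    using y(1) by (intro bexI[of _ "K #>\<^bsub>G\<^esub> y"]) (auto simp: K.FactGroup_pow carrier_FactGroup)
qed

lemma countable_divisible_part_FactGroup:
  assumes "comm_group G" "subgroup C G"
    and ctb: "countable {x \<in> carrier G. \<forall>n::nat. n > 0 \<longrightarrow>
      (\<exists>y\<in>carrier G. \<exists>c\<in>C. x = c \<otimes>\<^bsub>G\<^esub> y [^]\<^bsub>G\<^esub> n)}" (is "countable ?Q")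
  shows "countable (divisible_part (G Mod C))"
proof -
  interpret comm_group G by fact
  interpret C: normal C G using assms(2) by (simp add: subgroup_imp_normal)
  have "comm_group (G Mod C)" using abelian_FactGroup[OF assms(2)] .
  then have D: "divisible_part (G Mod C) \<subseteq> carrier (G Mod C)"
    "\<And>n X. n > (0::nat) \<Longrightarrow> X \<in> divisible_part (G Mod C) \<Longrightarrow>
      \<exists>Y\<in>divisible_part (G Mod C). Y [^]\<^bsub>G Mod C\<^esub> n = X"
    using divisible_part_is_largest(1)[of "G Mod C"] subgroup.subset
    unfolding divisible_subgroup_iff by blast+
  have "divisible_part (G Mod C) \<subseteq> (\<lambda>x. C #>\<^bsub>G\<^esub> x) ` ?Q"
  proof
    fix X assume X: "X \<in> divisible_part (G Mod C)"
    then obtain x where x: "x \<in> carrier G" "X = C #>\<^bsub>G\<^esub> x"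
      using D(1) by (auto simp: carrier_FactGroup)
    have "\<exists>y\<in>carrier G. \<exists>c\<in>C. x = c \<otimes>\<^bsub>G\<^esub> y [^]\<^bsub>G\<^esub> n" if n: "n > 0" for n :: nat
    proof -
      obtain Y where Y: "Y \<in> divisible_part (G Mod C)" "Y [^]\<^bsub>G Mod C\<^esub> n = X"
        using D(2)[OF n X] by blast
      then obtain y where y: "y \<in> carrier G" "Y = C #>\<^bsub>G\<^esub> y"
        using D(1) by (auto simp: carrier_FactGroup)
      have "X = C #>\<^bsub>G\<^esub> (y [^]\<^bsub>G\<^esub> n)" using Y(2) y by (simp add: C.FactGroup_pow)
      moreover have "x \<in> X" using x rcos_self[OF _ assms(2)] by simp
      ultimately show ?thesis using y(1) by (auto simp: r_coset_def)
    qed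
    then show "X \<in> (\<lambda>x. C #>\<^bsub>G\<^esub> x) ` ?Q" using x by blast
  qed
  then show ?thesis by (rule countable_subset) (rule countable_image[OF ctb])
qed

text \<open>
  Transport of the pointwise addition on \<open>M\<close> to an arbitrary set of the same cardinality.
\<close>

lemma subspace_as_group:
  fixes M :: "('i \<Rightarrow> int) set" and A :: "'c set"
  assumes M: "fun_int.subspace M" and A: "|M| =o |A|"
  obtains G :: "'c monoid" and \<psi> where "comm_group G" "carrier G = A" "bij_betw \<psi> A M"
    "\<And>x y. x \<in> A \<Longrightarrow> y \<in> A \<Longrightarrow> \<psi> (x \<otimes>\<^bsub>G\<^esub> y) = \<psi> x + \<psi> y"
    "\<psi> \<one>\<^bsub>G\<^esub> = 0" "\<And>x n. x \<in> A \<Longrightarrow> \<psi> (x [^]\<^bsub>G\<^esub> (n::nat)) = scale (int n) (\<psi> x)"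
proof -
  obtain \<psi> where \<psi>: "bij_betw \<psi> A M"
    using ordIso_symmetric[OF A] card_of_ordIso[of A M] by blast
  define \<phi> where "\<phi> = inv_into A \<psi>"
  have \<psi>\<phi>: "\<psi> (\<phi> g) = g" "\<phi> g \<in> A" if "g \<in> M" for g
    using \<psi> that by (auto simp: \<phi>_def bij_betw_def inv_into_into f_inv_into_f)
  have \<phi>\<psi>: "\<phi> (\<psi> x) = x" "\<psi> x \<in> M" if "x \<in> A" for x
    using \<psi> that by (auto simp: \<phi>_def bij_betw_def)
  note sub = fun_int.subspace_0[OF M] fun_int.subspace_add[OF M] fun_int.subspace_neg[OF M]
  define G where "G = \<lparr>carrier = A, monoid.mult = (\<lambda>x y. \<phi> (\<psi> x + \<psi> y)), one = \<phi> 0\<rparr>"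
  have G: "carrier G = A" "\<one>\<^bsub>G\<^esub> = \<phi> 0" "\<And>x y. x \<otimes>\<^bsub>G\<^esub> y = \<phi> (\<psi> x + \<psi> y)"
    by (simp_all add: G_def)
  have comm: "comm_group G"
  proof (rule comm_groupI)
    fix x assume "x \<in> carrier G"
    then show "\<exists>y\<in>carrier G. y \<otimes>\<^bsub>G\<^esub> x = \<one>\<^bsub>G\<^esub>"
      by (intro bexI[of _ "\<phi> (- \<psi> x)"]) (auto simp: G \<psi>\<phi> \<phi>\<psi> sub)
  qed (auto simp: G \<psi>\<phi> \<phi>\<psi> sub ac_simps)
  then interpret comm_group G .
  have pow: "\<psi> (x [^]\<^bsub>G\<^esub> n) = scale (int n) (\<psi> x)" if x: "x \<in> A" for x and n :: nat
  proof (induction n)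
    case 0
    then show ?case by (simp add: G \<psi>\<phi> sub scale_def fun_eq_iff)
  next
    case (Suc n)
    have "\<psi> (x [^]\<^bsub>G\<^esub> n) \<in> M" using x by (intro \<phi>\<psi>) (simp flip: G(1))
    then have "\<psi> (x [^]\<^bsub>G\<^esub> Suc n) = \<psi> (x [^]\<^bsub>G\<^esub> n) + \<psi> x"
      using x by (simp add: G(3) \<psi>\<phi> \<phi>\<psi> sub)
    then show ?case by (simp add: Suc scale_def fun_eq_iff algebra_simps)
  qed
  show ?thesis
    by (rule that[OF comm G(1) \<psi> _ _ pow]) (simp_all add: G \<psi>\<phi> \<phi>\<psi> sub fun_eq_iff)
qed

section \<open>The theorem\<close>

theorem theorem12:
  fixes k :: "'a rel"
  assumes "is_aleph_omega k" and "square k"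
  shows "\<exists>(G :: 'a set monoid) K.
           comm_group G \<and> reduced G \<and> |carrier G| =o cardSuc k \<and>
           subgroup K G \<and> |K| =o k \<and> divisible (G Mod K) \<and>
           (\<forall>C. subgroup C G \<and> countable C \<longrightarrow> countable (divisible_part (G Mod C)))"
proof -
  define r where "r = cardSuc k"
  obtain f :: "'a set \<Rightarrow> nat \<Rightarrow> 'a" where f: "\<And>\<delta> n. f \<delta> n \<in> Field k"
    "\<And>\<gamma> \<delta>. \<gamma> \<in> Field r \<Longrightarrow> \<delta> \<in> Field r \<Longrightarrow> \<gamma> \<noteq> \<delta> \<Longrightarrow> \<exists>m. \<forall>n\<ge>m. f \<gamma> n \<noteq> f \<delta> n"
    "\<And>X. countable X \<Longrightarrow> countable {\<delta> \<in> Field r. \<forall>m. \<exists>n\<ge>m. (n, f \<delta> n) \<in> X}"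
    using square_sparse_family[OF assms] unfolding r_def by blast
  interpret sparse_family "Field k" "Field r" f
  proof
    show "f \<alpha> n \<in> Field k" for \<alpha> n by (rule f(1))
    show "\<forall>\<^sub>F n in sequentially. f \<alpha> n \<noteq> f \<beta> n"
      if "\<alpha> \<in> Field r" "\<beta> \<in> Field r" "\<alpha> \<noteq> \<beta>" for \<alpha> \<beta>
      unfolding eventually_sequentially by (rule f(2)[OF that])
    show "countable {\<alpha> \<in> Field r. \<exists>\<^sub>F n in sequentially. (n, f \<alpha> n) \<in> X}" if "countable X" for X
      unfolding frequently_sequentially by (rule f(3)[OF that])
  qed
  have k: "Cinfinite k" by (rule aleph_omega_Cinfinite[OF assms(1)])
  then have Ck: "Card_order k" and infk: "infinite (Field k)" by (simp_all add: cinfinite_def)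
  have Cr: "Card_order r" "infinite (Field r)"
    using Cinfinite_cardSuc[OF k] by (simp_all add: r_def cinfinite_def)
  have kr: "|Field k| \<le>o r"
    unfolding r_def by (rule ordIso_ordLeq_trans[OF card_of_Field_ordIso[OF Ck] cardSuc_ordLeq[OF Ck]])
  have cM: "|M| =o r"
    by (rule card_of_M[OF Cr card_of_Field_ordIso[OF Cr(1)] kr])
  have cK: "|K| =o k"
    by (rule card_of_K[OF Ck infk card_of_Field_ordIso[OF Ck]])
  have "|M| =o |Field r|"
    using ordIso_transitive[OF cM ordIso_symmetric[OF card_of_Field_ordIso[OF Cr(1)]]] .
  from subspace_as_group[OF subspace_M this]
  obtain G :: "'a set monoid" and \<psi> where G: "comm_group G" "carrier G = Field r"
    and \<psi>: "bij_betw \<psi> (carrier G) M"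
    and \<psi>_mult: "\<And>x y. x \<in> carrier G \<Longrightarrow> y \<in> carrier G \<Longrightarrow> \<psi> (x \<otimes>\<^bsub>G\<^esub> y) = \<psi> x + \<psi> y"
    and \<psi>_one: "\<psi> \<one>\<^bsub>G\<^esub> = 0"
    and \<psi>_pow: "\<And>x n. x \<in> carrier G \<Longrightarrow> \<psi> (x [^]\<^bsub>G\<^esub> (n::nat)) = scale (int n) (\<psi> x)"
    by metis
  interpret comm_group G by fact
  have \<psi>_M: "\<psi> x \<in> M" if "x \<in> carrier G" for x
    using \<psi> that by (auto simp: bij_betw_def)
  have \<psi>_inj: "x = y" if "\<psi> x = \<psi> y" "x \<in> carrier G" "y \<in> carrier G" for x y
    using \<psi> that by (auto simp: bij_betw_def inj_on_def)
  have \<psi>_surj: "\<exists>x\<in>carrier G. \<psi> x = g" if "g \<in> M" for g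
  proof -
    have "g \<in> \<psi> ` carrier G" using \<psi> that by (simp add: bij_betw_def)
    then show ?thesis by blast
  qed
  have \<psi>_inv: "\<psi> (inv\<^bsub>G\<^esub> x) = - \<psi> x" if "x \<in> carrier G" for x
    using \<psi>_mult[of "inv\<^bsub>G\<^esub> x" x] that by (simp add: \<psi>_one eq_neg_iff_add_eq_0)
  \<comment> \<open>\<open>L\<close> is the copy in \<open>G\<close> of the finitely supported functions.\<close>
  define L where "L = {x \<in> carrier G. \<psi> x \<in> K}"
  have subK: "fun_int.subspace K" unfolding K_def by (rule fun_int.subspace_span)
  have L: "subgroup L G"
    by (rule subgroupI)
      (auto simp: L_def \<psi>_one \<psi>_mult \<psi>_inv fun_int.subspace_0[OF subK] fun_int.subspace_add[OF subK]
        fun_int.subspace_neg[OF subK] intro!: exI[of _ "\<one>\<^bsub>G\<^esub>"])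
  have "bij_betw \<psi> L K"
    using \<psi> \<psi>_surj K_subset_M by (auto simp: bij_betw_def L_def inj_on_def)
  then have "|L| =o k" using ordIso_transitive[OF card_of_ordIsoI cK] by blast
  moreover have "|carrier G| =o cardSuc k"
    unfolding G(2) r_def[symmetric] by (rule card_of_Field_ordIso[OF Cr(1)])
  moreover have "reduced G"
  proof (rule reduced_if_no_divisible_element[OF G(1)])
    fix x assume x: "x \<in> carrier G" "\<And>n::nat. n > 0 \<Longrightarrow> \<exists>y\<in>carrier G. y [^]\<^bsub>G\<^esub> n = x"
    then have "\<psi> x = 0" using \<psi>_pow by (intro M_reduced) metis
    then show "x = \<one>\<^bsub>G\<^esub>" using \<psi>_inj[of x "\<one>\<^bsub>G\<^esub>"] x(1) \<psi>_one by simp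
  qed
  moreover have "divisible (G Mod L)"
  proof (rule divisible_FactGroup[OF G(1) L])
    fix n :: nat and x assume n: "n > 0" and x: "x \<in> carrier G"
    obtain h c where hc: "h \<in> M" "c \<in> K" "\<psi> x = scale (int n) h + c"
      using M_div_K[OF \<psi>_M[OF x] n] by blast
    obtain y where y: "y \<in> carrier G" "\<psi> y = h" using \<psi>_surj[OF hc(1)] by blast
    obtain d where d: "d \<in> carrier G" "\<psi> d = c" using \<psi>_surj hc(2) K_subset_M by blast
    have "x = d \<otimes>\<^bsub>G\<^esub> y [^]\<^bsub>G\<^esub> n"
      using x y d hc(3) by (intro \<psi>_inj) (simp_all add: \<psi>_mult \<psi>_pow add.commute)
    then show "\<exists>y\<in>carrier G. \<exists>c\<in>L. x = c \<otimes>\<^bsub>G\<^esub> y [^]\<^bsub>G\<^esub> n"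
      using y d hc(2) by (auto simp: L_def)
  qed
  moreover have "countable (divisible_part (G Mod C))" if C: "subgroup C G" "countable C" for C
  proof (rule countable_divisible_part_FactGroup[OF G(1) C(1)])
    let ?Q = "{x \<in> carrier G. \<forall>n::nat. n > 0 \<longrightarrow>
      (\<exists>y\<in>carrier G. \<exists>c\<in>C. x = c \<otimes>\<^bsub>G\<^esub> y [^]\<^bsub>G\<^esub> n)}"
    have CG: "C \<subseteq> carrier G" using subgroup.subset[OF C(1)] .
    have "\<psi> ` ?Q \<subseteq> {g \<in> M. \<forall>N>0. \<exists>h\<in>M. \<exists>c\<in>\<psi> ` C. g = scale (int N) h + c}"
    proof safe
      fix x and N :: nat
      assume N: "N > 0" and "\<forall>n::nat. n > 0 \<longrightarrow>
        (\<exists>y\<in>carrier G. \<exists>c\<in>C. x = c \<otimes>\<^bsub>G\<^esub> y [^]\<^bsub>G\<^esub> n)"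
      then obtain y c where y: "y \<in> carrier G" "c \<in> C" "x = c \<otimes>\<^bsub>G\<^esub> y [^]\<^bsub>G\<^esub> N" by metis
      then have "\<psi> x = scale (int N) (\<psi> y) + \<psi> c"
        using CG by (simp add: \<psi>_mult \<psi>_pow subset_iff add.commute)
      then show "\<exists>h\<in>M. \<exists>c\<in>\<psi> ` C. \<psi> x = scale (int N) h + c"
        using y(1,2) \<psi>_M by blast
    qed (rule \<psi>_M)
    moreover have "countable {g \<in> M. \<forall>N>0. \<exists>h\<in>M. \<exists>c\<in>\<psi> ` C. g = scale (int N) h + c}"
      using C(2) CG \<psi>_M by (intro countable_divisible_modulo) auto
    ultimately have "countable (\<psi> ` ?Q)" by (rule countable_subset)
    moreover have "inj_on \<psi> ?Q" using \<psi>_inj by (auto intro!: inj_onI)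
    ultimately show "countable ?Q" by (rule countable_image_inj_on)
  qed
  ultimately show ?thesis using G(1) L by blast
qed

end
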